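(* Let $1\le T\le n$, let $\Sigma$ be a $T\times T$ positive semidefinite matrix and $\Omega$ an upper triangular $T\times T$ matrix with nonnegative diagonal entries such that $\Sigma=\Omega^\top\Omega$, and let $f_t,m_t\colon(\mathbb{R}^n)^{t-1}\to\mathbb{R}^n$ ($t\in[T]$) be measurable. Let $(q_t,z_t,w_t,y_t)_{t\in[T]}$ be produced by the coupling construction described in the context. Then $z_1,\dots,z_T$ are independent with $z_t\sim\mathsf{N}(0,\mathrm{I}_n)$; consequently $(w_t)_{t\in[T]}$ is a mean-zero Gaussian process with $\operatorname{cov}(w_s,w_t)=\Sigma_{st}\mathrm{I}_n$, and $(y_t)$ has the law of the process $y_t=m_t(y_{<t})+w_t$ with such $w$. Moreover, for all $1\le t\le r\le T$, $$z_t=Aq_t-\frac1n\sum_{s\le r}\langle z_s,q_t\rangle\,q_s+\sum_{s\le r}A'_{st}\,q_s .$$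
   Context: $\mathsf{GOE}(n)$ denotes the law of a symmetric $n\times n$ random matrix with independent $\mathsf{N}(0,2/n)$ diagonal entries and independent $\mathsf{N}(0,1/n)$ entries below the diagonal. Coupling construction: let $A,A'$ be i.i.d. $\mathsf{GOE}(n)$, and fix an ordered basis $(v_1,\dots,v_n)$ of $\mathbb{R}^n$. For $t=1,\dots,T$: (1) if $f_t(y_{<t})\notin\operatorname{span}\{q_1,\dots,q_{t-1}\}$, let $q_t$ be the vector of norm $\sqrt n$ proportional to $f_t(y_{<t})-\sum_{s<t}\frac1n\langle q_s,f_t(y_{<t})\rangle q_s$; otherwise do the same with $f_t(y_{<t})$ replaced by the first basis vector $v_j$ not in $\operatorname{span}\{q_1,\dots,q_{t-1}\}$. (2) Set $$z_t=Aq_t+\tfrac12\big(A'_{tt}-\tfrac1n\langle q_t,Aq_t\rangle\big)q_t+\sum_{s<t}\big(A'_{st}-\tfrac1n\langle q_s,Aq_t\rangle\big)q_s,$$ $w_t=\sum_{s\le t}\Omega_{st}z_s$, and $y_t=m_t(y_{<t})+w_t$. Here $A'_{st}$ denotes the $(s,t)$ entry of $A'$ (symmetric, so $A'_{st}=A'_{ts}$); $f_1,m_1$ are constant vectors. *)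

theory Defs
  imports "HOL-Probability.Probability"
begin

text \<open>Step (1) of the coupling construction: given the time t, the fixed ordered
  basis v (indexed 1..n), the previously constructed q_1..q_(t-1) and the vector
  x = f_t(y_<t), return q_t.\<close>
definition gs_next :: "nat \<Rightarrow> (nat \<Rightarrow> real^'n) \<Rightarrow> (nat \<Rightarrow> real^'n) \<Rightarrow> real^'n \<Rightarrow> real^'n" where
  "gs_next t v q x =
     (let P = q ` {1..<t};
          u = (if x \<notin> span P then x
               else v (LEAST j. j \<in> {1..CARD('n)} \<and> v j \<notin> span P));
          r = u - (\<Sum>s\<in>{1..<t}. ((1 / real CARD('n)) * (q s \<bullet> u)) *\<^sub>R q s)
      in (sqrt (real CARD('n)) / norm r) *\<^sub>R r)"

text \<open>Step (2): the vector z_t. The matrix entry A'_{st} is \<open>A' $ e s $ e t\<close>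
  where e : {1..n} -> 'n is the fixed enumeration of coordinates.\<close>
definition z_next :: "nat \<Rightarrow> (nat \<Rightarrow> 'n) \<Rightarrow> real^'n^'n \<Rightarrow> real^'n^'n \<Rightarrow> (nat \<Rightarrow> real^'n) \<Rightarrow> real^'n" where
  "z_next t e A A' q =
     A *v q t
     + ((1/2) * (A' $ e t $ e t - (1 / real CARD('n)) * (q t \<bullet> (A *v q t)))) *\<^sub>R q t
     + (\<Sum>s\<in>{1..<t}. (A' $ e s $ e t - (1 / real CARD('n)) * (q s \<bullet> (A *v q t))) *\<^sub>R q s)"

definition two_iid_GOE :: "'a measure \<Rightarrow> (nat \<Rightarrow> 'n) \<Rightarrow> ('a \<Rightarrow> real^'n^'n) \<Rightarrow> ('a \<Rightarrow> real^'n^'n) \<Rightarrow> bool" where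
  "two_iid_GOE M e A A' \<longleftrightarrow>
     (\<forall>\<omega>\<in>space M. transpose (A \<omega>) = A \<omega> \<and> transpose (A' \<omega>) = A' \<omega>) \<and>
     prob_space.indep_vars M (\<lambda>_. borel)
        (\<lambda>(b, i, j) \<omega>. (if b then A' \<omega> else A \<omega>) $ e i $ e j)
        (UNIV \<times> {(i, j). 1 \<le> i \<and> i \<le> j \<and> j \<le> CARD('n)}) \<and>
     (\<forall>b i j. 1 \<le> i \<and> i \<le> j \<and> j \<le> CARD('n) \<longrightarrow>
        distributed M lborel (\<lambda>\<omega>. (if b then A' \<omega> else A \<omega>) $ e i $ e j)
          (normal_density 0 (if i = j then sqrt (2 / real CARD('n)) else sqrt (1 / real CARD('n)))))"

definition centered_gaussian_family :: "'a measure \<Rightarrow> ('i \<Rightarrow> 'a \<Rightarrow> real) \<Rightarrow> 'i set \<Rightarrow> bool" where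
  "centered_gaussian_family M X I \<longleftrightarrow>
     (\<forall>i\<in>I. X i \<in> borel_measurable M) \<and>
     (\<forall>c :: 'i \<Rightarrow> real.
        (AE \<omega> in M. (\<Sum>i\<in>I. c i * X i \<omega>) = 0) \<or>
        (\<exists>\<sigma>>0. distributed M lborel (\<lambda>\<omega>. \<Sum>i\<in>I. c i * X i \<omega>) (normal_density 0 \<sigma>)))"

definition gaussian_process_cov :: "'a measure \<Rightarrow> nat \<Rightarrow> (nat \<Rightarrow> nat \<Rightarrow> real) \<Rightarrow> (nat \<Rightarrow> 'a \<Rightarrow> real^'n) \<Rightarrow> bool" where
  "gaussian_process_cov M T Sig w \<longleftrightarrow>
     centered_gaussian_family M (\<lambda>(t, i) \<omega>. w t \<omega> $ i) ({1..T} \<times> UNIV) \<and>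
     (\<forall>s\<in>{1..T}. \<forall>t\<in>{1..T}. \<forall>i j.
        prob_space.expectation M (\<lambda>\<omega>. w s \<omega> $ i * w t \<omega> $ j) = (if i = j then Sig s t else 0))"

end

theory Submission
  imports Defs
begin

text \<open>For a fixed orthogonal family \<open>q\<^sub>1, \<dots>, q\<^sub>t\<close> of vectors of norm \<open>\<surd>n\<close>, let \<open>P\<close> be the projection onto its
  orthogonal complement. The vector \<open>z\<^sub>t\<close> is a linear image of the Gaussian pair \<open>(A, A')\<close>; comparing
  characteristic functions shows that it is standard Gaussian and independent of \<open>P A P\<close> together with the
  entries of \<open>A'\<close> outside the leading \<open>t \<times> t\<close> block. All later \<open>z\<^sub>s\<close> depend on \<open>(A, A')\<close> only through these
  data and through the previous \<open>z\<^sub>r\<close>. Hence, by Fubini and backward induction on \<open>t\<close>, with the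
  history \<open>z\<^sub>1, \<dots>, z\<^sub>t\<^sub>-\<^sub>1\<close> frozen to an arbitrary value, the vectors \<open>z\<^sub>t, \<dots>, z\<^sub>T\<close> produced by the
  recursion are i.i.d. standard Gaussian. A centered Gaussian process is determined by its covariance, and
  \<open>y\<close> is a measurable function of \<open>w\<close>, which gives the law of \<open>y\<close>.\<close>

section \<open>Characteristic functions determine finite measures on Euclidean spaces\<close>

text \<open>The obstacle is adaptivity: \<open>q t\<close> is a function of the earlier
  \<open>z s\<close>, so \<open>z t\<close> is not a linear image of \<open>(A, A')\<close>.
  Freezing the history makes the directions deterministic; the price is that every statement must
  hold for all histories, including those of probability zero. The shape of \<open>z_next\<close>
  comes from a variance count. For s < t, symmetry gives <q_s, A q_t> = <z_s, q_t>, which is already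
  revealed; this component is removed and replaced by fresh noise A'_{st} of the right size. Along
  q_t itself the quadratic form of A has twice the desired variance, and averaging it with the
  independent n A'_{tt} halves it. Laws are compared through characteristic functions because the
  deflated matrices are degenerate Gaussians without densities. Independence then becomes additivity
  of a quadratic form, that is, orthogonality of symmetrized coefficient matrices.\<close>

lemma cis_sum: "cis (sum g I) = (\<Prod>i\<in>I. cis (g i))"
  by (induction I rule: infinite_finite_induct) (auto simp: cis_mult[symmetric])

lemma borel_measurable_cis [measurable]:
  "f \<in> borel_measurable M \<Longrightarrow> (\<lambda>x. cis (f x)) \<in> borel_measurable M"
  by (rule borel_measurable_continuous_on[OF continuous_on_cis[OF continuous_on_id]])

lemma (in finite_measure) integrable_cis:
  "f \<in> borel_measurable M \<Longrightarrow> integrable M (\<lambda>x. cis (f x))"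
  by (rule integrable_const_bound[where B=1]) auto

lemma finite_measure_eq_if_char_eq_real:
  fixes X :: "'a \<Rightarrow> real" and Y :: "'b \<Rightarrow> real"
  assumes "finite_measure M" "finite_measure N"
    and [measurable]: "X \<in> borel_measurable M" "Y \<in> borel_measurable N"
    and eq: "\<And>t. (\<integral>x. cis (t * X x) \<partial>M) = (\<integral>x. cis (t * Y x) \<partial>N)"
  shows "distr M borel X = distr N borel Y"
proof -
  interpret M: finite_measure M by fact
  interpret N: finite_measure N by fact
  define c where "c = measure M (space M)"
  have "of_real (measure M (space M)) = (of_real (measure N (space N)) :: complex)"
    using eq[of 0] by (simp add: scaleR_conv_of_real)
  then have cN: "c = measure N (space N)"
    by (simp add: c_def)
  have em: "emeasure M (space M) = ennreal c" "emeasure N (space N) = ennreal c"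
    by (simp_all add: cN c_def M.emeasure_eq_measure N.emeasure_eq_measure flip: cN)
  show ?thesis
  proof (cases "c = 0")
    case True
    have "emeasure M A = 0" "emeasure N B = 0" for A B
      using emeasure_space[of M A] emeasure_space[of N B] em True by simp_all
    then show ?thesis
      by (intro measure_eqI) (auto simp: emeasure_distr)
  next
    case False
    then have c: "c > 0"
      by (simp add: c_def zero_less_measure_iff order_less_le)
    define D where "D = (\<lambda>L::real measure. density L (\<lambda>_. ennreal (1 / c)))"
    have cc: "ennreal (1 / c) * ennreal c = 1"
      using c by (simp flip: ennreal_mult)
    have prD: "real_distribution (D L)" if "sets L = sets borel" "emeasure L (space L) = ennreal c" for L
    proof -
      have "emeasure (D L) (space (D L)) = 1"
        unfolding D_def using that cc by (subst emeasure_density_const) (auto simp: sets_eq_imp_space_eq)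
      then show ?thesis
        using that by (auto simp: real_distribution_def real_distribution_axioms_def D_def prob_spaceI)
    qed
    have 1: "real_distribution (D (distr M borel X))"
      using em by (intro prD) (auto simp: emeasure_distr)
    have 2: "real_distribution (D (distr N borel Y))"
      using em by (intro prD) (auto simp: emeasure_distr)
    have "char (D (distr M borel X)) = char (D (distr N borel Y))"
    proof
      fix t
      show "char (D (distr M borel X)) t = char (D (distr N borel Y)) t"
        unfolding char_def D_def using c eq[of t]
        by (simp add: integral_density integral_distr cis_conv_exp[symmetric] flip: of_real_mult)
    qed
    from Levy_uniqueness[OF 1 2 this] have D: "D (distr M borel X) = D (distr N borel Y)" .
    show ?thesis
    proof (rule measure_eqI)
      fix A assume "A \<in> sets (distr M borel X)"
      then have A: "A \<in> sets borel" by simp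
      have "emeasure (D (distr M borel X)) A = emeasure (D (distr N borel Y)) A"
        by (simp add: D)
      then have "ennreal (1 / c) * emeasure (distr M borel X) A = ennreal (1 / c) * emeasure (distr N borel Y) A"
        using A unfolding D_def by (simp add: emeasure_density_const)
      then have "(ennreal c * ennreal (1 / c)) * emeasure (distr M borel X) A
               = (ennreal c * ennreal (1 / c)) * emeasure (distr N borel Y) A"
        by (simp add: mult.assoc)
      then show "emeasure (distr M borel X) A = emeasure (distr N borel Y) A"
        using cc by (simp add: mult.commute)
    qed simp
  qed
qed

text \<open>For \<open>norm a \<le> 1\<close> the weight is nonnegative and so defines a measure;
  the right-hand side shows how the complex integral is recovered from finitely many choices of
  \<open>a\<close>.\<close>

lemma (in finite_measure) integral_indicator_weight:
  fixes X :: "'a \<Rightarrow> 'e :: euclidean_space"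
  assumes [measurable]: "X \<in> borel_measurable M" "S \<in> borel_measurable M" "B \<in> sets borel"
  shows "(\<integral>x. indicat_real B (X x) * (1 + Re (a * cis (S x))) \<partial>M)
      = (\<integral>x. indicat_real B (X x) \<partial>M) + Re (a * (\<integral>x. indicat_real B (X x) *\<^sub>R cis (S x) \<partial>M))"
proof -
  have i: "integrable M (\<lambda>x. indicat_real B (X x) *\<^sub>R cis (S x))"
    by (rule integrable_const_bound[where B=1]) (auto simp: indicator_def)
  have "(\<integral>x. indicat_real B (X x) * (1 + Re (a * cis (S x))) \<partial>M)
     = (\<integral>x. indicat_real B (X x) + Re (a * (indicat_real B (X x) *\<^sub>R cis (S x))) \<partial>M)"
    by (intro Bochner_Integration.integral_cong) (auto simp: algebra_simps)
  also have "\<dots> = (\<integral>x. indicat_real B (X x) \<partial>M) + (\<integral>x. Re (a * (indicat_real B (X x) *\<^sub>R cis (S x))) \<partial>M)"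
    by (intro Bochner_Integration.integral_add integrable_Re integrable_mult_right i integrable_const_bound[where B=1])
      (auto simp: indicator_def)
  also have "(\<integral>x. Re (a * (indicat_real B (X x) *\<^sub>R cis (S x))) \<partial>M)
      = Re (\<integral>x. a * (indicat_real B (X x) *\<^sub>R cis (S x)) \<partial>M)"
    by (rule integral_Re) (intro integrable_mult_right i)
  also have "(\<integral>x. a * (indicat_real B (X x) *\<^sub>R cis (S x)) \<partial>M) = a * (\<integral>x. indicat_real B (X x) *\<^sub>R cis (S x) \<partial>M)"
    by (rule integral_mult_right_zero)
  finally show ?thesis .
qed

text \<open>Peeling off one variable at a time: the nonnegative weights \<open>1 + cos S\<close> and \<open>1 + sin S\<close>
  reduce the signed measures \<open>cos S dM\<close> and \<open>sin S dM\<close> to finite measures,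
  to which the uniqueness theorem for a single variable applies.\<close>

lemma weighted_measure_eq:
  fixes X :: "'a \<Rightarrow> 'e :: euclidean_space" and Y :: "'b \<Rightarrow> 'e"
  assumes uniq: "\<And>(M :: 'a measure) (N :: 'b measure). finite_measure M \<Longrightarrow> finite_measure N \<Longrightarrow>
       X \<in> borel_measurable M \<Longrightarrow> Y \<in> borel_measurable N \<Longrightarrow>
       (\<And>c. (\<integral>x. cis (c \<bullet> X x) \<partial>M) = (\<integral>x. cis (c \<bullet> Y x) \<partial>N)) \<Longrightarrow> distr M borel X = distr N borel Y"
    and "finite_measure M" "finite_measure N"
    and [measurable]: "X \<in> borel_measurable M" "Y \<in> borel_measurable N"
    and [measurable]: "S \<in> borel_measurable M" "R \<in> borel_measurable N"
    and eq: "\<And>c k. k \<in> {-1, 0, 1} \<Longrightarrow>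
      (\<integral>x. cis (c \<bullet> X x + k * S x) \<partial>M) = (\<integral>x. cis (c \<bullet> Y x + k * R x) \<partial>N)"
    and [measurable]: "B \<in> sets borel"
  shows "(\<integral>x. indicat_real B (X x) *\<^sub>R cis (S x) \<partial>M) = (\<integral>x. indicat_real B (Y x) *\<^sub>R cis (R x) \<partial>N)"
proof -
  interpret M: finite_measure M by fact
  interpret N: finite_measure N by fact
  have key: "(\<integral>x. indicat_real B (X x) * (1 + Re (a * cis (S x))) \<partial>M)
    = (\<integral>x. indicat_real B (Y x) * (1 + Re (a * cis (R x))) \<partial>N)" if a: "norm a = 1 \<or> a = 0" for a :: complex
  proof -
    define G where "G = (\<lambda>s. 1 + Re (a * cis s))"
    have [measurable]: "G \<in> borel_measurable borel"
      unfolding G_def by measurable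
    have nn: "0 \<le> G x" and bd: "G x \<le> 2" for x
      using abs_Re_le_cmod[of "a * cis x"] a by (auto simp: norm_mult G_def)
    have bd': "ennreal (G x) \<le> 2" for x
      using ennreal_leI[OF bd[of x]] by simp
    define M' where "M' = density M (\<lambda>x. ennreal (G (S x)))"
    define N' where "N' = density N (\<lambda>x. ennreal (G (R x)))"
    have "emeasure M' (space M') \<le> (\<integral>\<^sup>+x. ennreal 2 \<partial>M)"
      unfolding M'_def by (subst emeasure_density) (auto intro!: nn_integral_mono bd' simp: indicator_def simp del: nn_integral_const)
    then have finM: "finite_measure M'"
      by (intro finite_measureI) (auto simp: ennreal_mult_eq_top_iff top_unique)
    have "emeasure N' (space N') \<le> (\<integral>\<^sup>+x. ennreal 2 \<partial>N)"
      unfolding N'_def by (subst emeasure_density) (auto intro!: nn_integral_mono bd' simp: indicator_def simp del: nn_integral_const)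
    then have finN: "finite_measure N'"
      by (intro finite_measureI) (auto simp: ennreal_mult_eq_top_iff top_unique)
    \<comment> \<open>Multiplying by the weight only shifts the frequency of \<open>S\<close> by 0,
      1 or -1; these are the three values of \<open>k\<close> in the assumption
      \<open>eq\<close>.\<close>
    have expand: "G s *\<^sub>R cis r
        = cis (r + 0 * s) + (a / 2) * cis (r + 1 * s) + (cnj a / 2) * cis (r + (-1) * s)" for r s
    proof -
      have "complex_of_real (G s) = 1 + (a * cis s + cnj (a * cis s)) / 2"
        by (auto simp: complex_eq_iff G_def)
      then show ?thesis
        by (simp add: scaleR_conv_of_real cis_cnj cis_mult[symmetric] algebra_simps add_divide_distrib diff_conv_add_uminus del: add_uminus_conv_diff)
    qed
    have "(\<integral>x. cis (c \<bullet> X x) \<partial>M') = (\<integral>x. cis (c \<bullet> Y x) \<partial>N')" for c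
    proof -
      have "(\<integral>x. cis (c \<bullet> X x) \<partial>M') = (\<integral>x. (G (S x)) *\<^sub>R cis (c \<bullet> X x) \<partial>M)"
        unfolding M'_def by (subst integral_density) (auto simp: nn)
      also have "\<dots> = (\<integral>x. cis (c \<bullet> X x + 0 * S x) \<partial>M) + (a / 2) * (\<integral>x. cis (c \<bullet> X x + 1 * S x) \<partial>M)
           + (cnj a / 2) * (\<integral>x. cis (c \<bullet> X x + (-1) * S x) \<partial>M)"
        unfolding expand by (subst Bochner_Integration.integral_add Bochner_Integration.integral_mult_right_zero; (intro Bochner_Integration.integrable_add integrable_mult_right M.integrable_cis)?; measurable?)+
      also have "\<dots> = (\<integral>x. cis (c \<bullet> Y x + 0 * R x) \<partial>N) + (a / 2) * (\<integral>x. cis (c \<bullet> Y x + 1 * R x) \<partial>N)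
           + (cnj a / 2) * (\<integral>x. cis (c \<bullet> Y x + (-1) * R x) \<partial>N)"
        using eq[of 0 c] eq[of 1 c] eq[of "-1" c] by simp
      also have "\<dots> = (\<integral>x. (G (R x)) *\<^sub>R cis (c \<bullet> Y x) \<partial>N)"
        unfolding expand by (subst Bochner_Integration.integral_add Bochner_Integration.integral_mult_right_zero; (intro Bochner_Integration.integrable_add integrable_mult_right N.integrable_cis)?; measurable?)+
      also have "\<dots> = (\<integral>x. cis (c \<bullet> Y x) \<partial>N')"
        unfolding N'_def by (subst integral_density) (auto simp: nn)
      finally show ?thesis .
    qed
    then have "distr M' borel X = distr N' borel Y"
      by (intro uniq finM finN) (auto simp: M'_def N'_def)
    then have "(\<integral>x. indicat_real B x \<partial>distr M' borel X) = (\<integral>x. indicat_real B x \<partial>distr N' borel Y)"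
      by simp
    moreover have "(\<integral>x. indicat_real B x \<partial>distr M' borel X) = (\<integral>x. indicat_real B (X x) * (G (S x)) \<partial>M)"
      unfolding M'_def by (subst integral_distr, simp, simp, subst integral_density) (auto simp: nn mult.commute)
    moreover have "(\<integral>x. indicat_real B x \<partial>distr N' borel Y) = (\<integral>x. indicat_real B (Y x) * (G (R x)) \<partial>N)"
      unfolding N'_def by (subst integral_distr, simp, simp, subst integral_density) (auto simp: nn mult.commute)
    ultimately show ?thesis by (simp add: G_def)
  qed
  note cM = M.integral_indicator_weight[OF \<open>X \<in> borel_measurable M\<close> \<open>S \<in> borel_measurable M\<close> \<open>B \<in> sets borel\<close>]
  note cN = N.integral_indicator_weight[OF \<open>Y \<in> borel_measurable N\<close> \<open>R \<in> borel_measurable N\<close> \<open>B \<in> sets borel\<close>]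
  note k = key[unfolded cM cN]
  show ?thesis
    \<comment> \<open>\<open>a = 0\<close> gives the unweighted terms, which then cancel;
      \<open>a = 1\<close> yields the real parts and \<open>a = \<i>\<close> the imaginary
      parts.\<close>
    using k[of 0] k[of 1] k[of "\<i>"] by (intro complex_eqI) auto
qed

text \<open>Induction on \<open>I\<close>: restricting both measures to the events for the index
  \<open>i\<close> keeps them finite, and \<open>weighted_measure_eq\<close>, with the remaining sum
  as \<open>S\<close>, transfers the hypothesis to the restrictions. Uniqueness for one variable is
  an assumption so that the lemma serves twice: from reals to Euclidean vectors, then from vectors
  to finite families.\<close>

lemma measure_family_eq_if_char_eq:
  fixes X :: "'i \<Rightarrow> 'a \<Rightarrow> 'e :: euclidean_space" and Y :: "'i \<Rightarrow> 'b \<Rightarrow> 'e"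
  assumes uniq: "\<And>(M :: 'a measure) (N :: 'b measure) X Y. finite_measure M \<Longrightarrow> finite_measure N \<Longrightarrow>
       X \<in> borel_measurable M \<Longrightarrow> Y \<in> borel_measurable N \<Longrightarrow>
       (\<And>c :: 'e. (\<integral>x. cis (c \<bullet> X x) \<partial>M) = (\<integral>x. cis (c \<bullet> Y x) \<partial>N)) \<Longrightarrow> distr M borel X = distr N borel Y"
    and "finite I" "finite_measure M" "finite_measure N"
    and "\<And>i. i \<in> I \<Longrightarrow> X i \<in> borel_measurable M" "\<And>i. i \<in> I \<Longrightarrow> Y i \<in> borel_measurable N"
    and "\<And>c. (\<integral>x. cis (\<Sum>i\<in>I. c i \<bullet> X i x) \<partial>M) = (\<integral>x. cis (\<Sum>i\<in>I. c i \<bullet> Y i x) \<partial>N)"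
    and "\<And>i. i \<in> I \<Longrightarrow> B i \<in> sets borel"
  shows "measure M {x \<in> space M. \<forall>i\<in>I. X i x \<in> B i} = measure N {x \<in> space N. \<forall>i\<in>I. Y i x \<in> B i}"
  using assms(2-)
proof (induction I arbitrary: M N rule: finite_induct)
  case empty
  have "complex_of_real (measure M (space M)) = of_real (measure N (space N))"
    using empty(5)[of undefined] by (simp add: scaleR_conv_of_real)
  then show ?case by simp
next
  case (insert i I)
  interpret M: finite_measure M by fact
  interpret N: finite_measure N by fact
  have [measurable]: "X i \<in> borel_measurable M" "Y i \<in> borel_measurable N" "B i \<in> sets borel"
    "\<And>j. j \<in> I \<Longrightarrow> X j \<in> borel_measurable M" "\<And>j. j \<in> I \<Longrightarrow> Y j \<in> borel_measurable N"
    "\<And>j. j \<in> I \<Longrightarrow> B j \<in> sets borel"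
    using insert.prems by auto
  define M' where "M' = density M (\<lambda>x. ennreal (indicat_real (B i) (X i x)))"
  define N' where "N' = density N (\<lambda>x. ennreal (indicat_real (B i) (Y i x)))"
  have [simp]: "space M' = space M" "space N' = space N"
    by (simp_all add: M'_def N'_def)
  have EM: "emeasure M' A = emeasure M {x \<in> space M. X i x \<in> B i \<and> x \<in> A}" if [measurable]: "A \<in> sets M" for A
  proof -
    have "emeasure M' A = (\<integral>\<^sup>+x. indicator {x \<in> space M. X i x \<in> B i \<and> x \<in> A} x \<partial>M)"
      unfolding M'_def by (subst emeasure_density; (rule nn_integral_cong, auto simp: indicator_def; fail)?) auto
    also have "\<dots> = emeasure M {x \<in> space M. X i x \<in> B i \<and> x \<in> A}"
      by (rule nn_integral_indicator) measurable
    finally show ?thesis .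
  qed
  have EN: "emeasure N' A = emeasure N {x \<in> space N. Y i x \<in> B i \<and> x \<in> A}" if [measurable]: "A \<in> sets N" for A
  proof -
    have "emeasure N' A = (\<integral>\<^sup>+x. indicator {x \<in> space N. Y i x \<in> B i \<and> x \<in> A} x \<partial>N)"
      unfolding N'_def by (subst emeasure_density; (rule nn_integral_cong, auto simp: indicator_def; fail)?) auto
    also have "\<dots> = emeasure N {x \<in> space N. Y i x \<in> B i \<and> x \<in> A}"
      by (rule nn_integral_indicator) measurable
    finally show ?thesis .
  qed
  have "measure M' {x \<in> space M'. \<forall>j\<in>I. X j x \<in> B j} = measure N' {x \<in> space N'. \<forall>j\<in>I. Y j x \<in> B j}"
  proof (rule insert.IH)
    show "finite_measure M'"
      by (intro finite_measureI) (simp add: EM)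
    show "finite_measure N'"
      by (intro finite_measureI) (simp add: EN)
    show "X j \<in> borel_measurable M'" "Y j \<in> borel_measurable N'" "B j \<in> sets borel" if "j \<in> I" for j
      using that by (simp_all add: M'_def N'_def)
    fix c :: "'i \<Rightarrow> 'e"
    have "(\<integral>x. indicat_real (B i) (X i x) *\<^sub>R cis (\<Sum>j\<in>I. c j \<bullet> X j x) \<partial>M)
        = (\<integral>x. indicat_real (B i) (Y i x) *\<^sub>R cis (\<Sum>j\<in>I. c j \<bullet> Y j x) \<partial>N)"
    proof (rule weighted_measure_eq[OF uniq])
      fix d :: 'e and k :: real
      \<comment> \<open>Scaling the remaining coefficients by \<open>k\<close> makes the shifted
        frequencies instances of the hypothesis.\<close>
      define c' where "c' j = (if j = i then d else k *\<^sub>R c j)" for j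
      have *: "(\<Sum>j\<in>insert i I. c' j \<bullet> Z j) = d \<bullet> Z i + k * (\<Sum>j\<in>I. c j \<bullet> Z j)" for Z
      proof -
        have "(\<Sum>j\<in>I. c' j \<bullet> Z j) = (\<Sum>j\<in>I. k * (c j \<bullet> Z j))"
          using insert.hyps by (intro sum.cong) (auto simp: c'_def)
        then show ?thesis
          using insert.hyps by (simp add: c'_def sum_distrib_left)
      qed
      show "(\<integral>x. cis (d \<bullet> X i x + k * (\<Sum>j\<in>I. c j \<bullet> X j x)) \<partial>M) = (\<integral>x. cis (d \<bullet> Y i x + k * (\<Sum>j\<in>I. c j \<bullet> Y j x)) \<partial>N)"
        using insert.prems(5)[of c'] unfolding * .
    qed (auto intro: insert.prems)
    moreover have "(\<integral>x. cis (\<Sum>j\<in>I. c j \<bullet> X j x) \<partial>M') = (\<integral>x. indicat_real (B i) (X i x) *\<^sub>R cis (\<Sum>j\<in>I. c j \<bullet> X j x) \<partial>M)"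
      unfolding M'_def by (subst integral_density) auto
    moreover have "(\<integral>x. cis (\<Sum>j\<in>I. c j \<bullet> Y j x) \<partial>N') = (\<integral>x. indicat_real (B i) (Y i x) *\<^sub>R cis (\<Sum>j\<in>I. c j \<bullet> Y j x) \<partial>N)"
      unfolding N'_def by (subst integral_density) auto
    ultimately show "(\<integral>x. cis (\<Sum>j\<in>I. c j \<bullet> X j x) \<partial>M') = (\<integral>x. cis (\<Sum>j\<in>I. c j \<bullet> Y j x) \<partial>N')"
      by simp
  qed
  moreover have "measure M' {x \<in> space M'. \<forall>j\<in>I. X j x \<in> B j} = measure M {x \<in> space M. \<forall>j\<in>insert i I. X j x \<in> B j}"
  proof -
    have [measurable]: "{x \<in> space M. \<forall>j\<in>I. X j x \<in> B j} \<in> sets M"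
      using insert.hyps by measurable
    show ?thesis
      by (simp add: measure_def EM) (intro arg_cong[where f=enn2real] arg_cong[where f="emeasure M"]; auto)
  qed
  moreover have "measure N' {x \<in> space N'. \<forall>j\<in>I. Y j x \<in> B j} = measure N {x \<in> space N. \<forall>j\<in>insert i I. Y j x \<in> B j}"
  proof -
    have [measurable]: "{x \<in> space N. \<forall>j\<in>I. Y j x \<in> B j} \<in> sets N"
      using insert.hyps by measurable
    show ?thesis
      by (simp add: measure_def EN) (intro arg_cong[where f=enn2real] arg_cong[where f="emeasure N"]; auto)
  qed
  ultimately show ?case by simp
qed

text \<open>Open boxes are products of intervals, so the family lemma applied to the coordinates of
  \<open>X\<close> and \<open>Y\<close> covers an intersection-stable generator of the Borel
  sets.\<close>

theorem finite_measure_eq_if_char_eq: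
  fixes X :: "'a \<Rightarrow> 'e :: euclidean_space" and Y :: "'b \<Rightarrow> 'e"
  assumes "finite_measure M" "finite_measure N"
    and [measurable]: "X \<in> borel_measurable M" "Y \<in> borel_measurable N"
    and eq: "\<And>c. (\<integral>x. cis (c \<bullet> X x) \<partial>M) = (\<integral>x. cis (c \<bullet> Y x) \<partial>N)"
  shows "distr M borel X = distr N borel Y"
proof -
  interpret M: finite_measure M by fact
  interpret N: finite_measure N by fact
  have m: "measure M {x \<in> space M. \<forall>i\<in>Basis. X x \<bullet> i \<in> B i} = measure N {x \<in> space N. \<forall>i\<in>Basis. Y x \<bullet> i \<in> B i}"
    if "\<And>i. i \<in> Basis \<Longrightarrow> B i \<in> sets borel" for B :: "'e \<Rightarrow> real set"
  proof (rule measure_family_eq_if_char_eq)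
    fix c :: "'e \<Rightarrow> real"
    have *: "(\<Sum>i\<in>Basis. c i \<bullet> (z \<bullet> i)) = (\<Sum>i\<in>Basis. c i *\<^sub>R i) \<bullet> z" for z
      by (simp add: inner_sum_left inner_commute[of z])
    show "(\<integral>x. cis (\<Sum>i\<in>Basis. c i \<bullet> (X x \<bullet> i)) \<partial>M) = (\<integral>x. cis (\<Sum>i\<in>Basis. c i \<bullet> (Y x \<bullet> i)) \<partial>N)"
      unfolding * by (rule eq)
  next
    fix M :: "'a measure" and N :: "'b measure" and X Y
    assume "finite_measure M" "finite_measure N" "X \<in> borel_measurable M" "Y \<in> borel_measurable N"
      "\<And>c :: real. (\<integral>x. cis (c \<bullet> X x) \<partial>M) = (\<integral>x. cis (c \<bullet> Y x) \<partial>N)"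
    then show "distr M borel X = distr N borel Y"
      by (intro finite_measure_eq_if_char_eq_real) auto
  qed (use that in \<open>auto intro: assms\<close>)
  show ?thesis
  proof (rule measure_eqI_generator_eq)
    show "Int_stable (range (\<lambda>(a, b). box a b :: 'e set))"
      by (auto simp: Int_stable_def box_Int_box)
    show "range (\<lambda>(a, b). box a b :: 'e set) \<subseteq> Pow UNIV"
      by auto
    show "sets (distr M borel X) = sigma_sets UNIV (range (\<lambda>(a, b). box a b))"
      "sets (distr N borel Y) = sigma_sets UNIV (range (\<lambda>(a, b). box a b))"
      by (simp_all add: borel_eq_box)
    show "range (\<lambda>n::nat. box (- (real n *\<^sub>R One)) (real n *\<^sub>R One) :: 'e set) \<subseteq> range (\<lambda>(a, b). box a b)"
      by auto
    show "(\<Union>n::nat. box (- (real n *\<^sub>R One)) (real n *\<^sub>R One)) = (UNIV :: 'e set)"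
      by (rule UN_box_eq_UNIV)
    show "emeasure (distr M borel X) (box (- (real n *\<^sub>R One)) (real n *\<^sub>R One)) \<noteq> \<infinity>" for n
      by (simp add: emeasure_distr M.emeasure_eq_measure)
    fix A :: "'e set" assume "A \<in> range (\<lambda>(a, b). box a b)"
    then obtain a b where A: "A = box a b" by auto
    have "measure M (X -` A \<inter> space M) = measure N (Y -` A \<inter> space N)"
    proof -
      have "X -` A \<inter> space M = {x \<in> space M. \<forall>i\<in>Basis. X x \<bullet> i \<in> {a \<bullet> i<..<b \<bullet> i}}"
        "Y -` A \<inter> space N = {x \<in> space N. \<forall>i\<in>Basis. Y x \<bullet> i \<in> {a \<bullet> i<..<b \<bullet> i}}"
        by (auto simp: A box_def)
      then show ?thesis
        using m[of "\<lambda>i. {a \<bullet> i<..<b \<bullet> i}"] by simp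
    qed
    then show "emeasure (distr M borel X) A = emeasure (distr N borel Y) A"
      by (simp add: A emeasure_distr M.emeasure_eq_measure N.emeasure_eq_measure)
  qed
qed

theorem distr_PiM_eq_if_char_eq:
  fixes X :: "'i \<Rightarrow> 'a \<Rightarrow> 'e :: euclidean_space" and Y :: "'i \<Rightarrow> 'b \<Rightarrow> 'e"
  assumes I: "finite I" and "finite_measure M" "finite_measure N"
    and [measurable]: "\<And>i. i \<in> I \<Longrightarrow> X i \<in> borel_measurable M" "\<And>i. i \<in> I \<Longrightarrow> Y i \<in> borel_measurable N"
    and eq: "\<And>c. (\<integral>x. cis (\<Sum>i\<in>I. c i \<bullet> X i x) \<partial>M) = (\<integral>x. cis (\<Sum>i\<in>I. c i \<bullet> Y i x) \<partial>N)"
  shows "distr M (PiM I (\<lambda>_. borel)) (\<lambda>x. \<lambda>i\<in>I. X i x) = distr N (PiM I (\<lambda>_. borel)) (\<lambda>x. \<lambda>i\<in>I. Y i x)"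
proof -
  interpret M: finite_measure M by fact
  interpret N: finite_measure N by fact
  show ?thesis
  proof (rule measure_eqI_PiM_finite[OF I])
    fix B :: "'i \<Rightarrow> 'e set" assume B: "\<And>i. i \<in> I \<Longrightarrow> B i \<in> sets borel"
    have "measure M {x \<in> space M. \<forall>i\<in>I. X i x \<in> B i} = measure N {x \<in> space N. \<forall>i\<in>I. Y i x \<in> B i}"
      using finite_measure_eq_if_char_eq assms B by (intro measure_family_eq_if_char_eq) blast+
    moreover have "(\<lambda>x. \<lambda>i\<in>I. X i x) -` Pi\<^sub>E I B \<inter> space M = {x \<in> space M. \<forall>i\<in>I. X i x \<in> B i}"
      "(\<lambda>x. \<lambda>i\<in>I. Y i x) -` Pi\<^sub>E I B \<inter> space N = {x \<in> space N. \<forall>i\<in>I. Y i x \<in> B i}"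
      by (auto simp: PiE_iff)
    moreover have "Pi\<^sub>E I B \<in> sets (PiM I (\<lambda>_. borel))"
      using I B by (intro sets_PiM_I_finite) auto
    ultimately show "emeasure (distr M (PiM I (\<lambda>_. borel)) (\<lambda>x. \<lambda>i\<in>I. X i x)) (Pi\<^sub>E I B)
        = emeasure (distr N (PiM I (\<lambda>_. borel)) (\<lambda>x. \<lambda>i\<in>I. Y i x)) (Pi\<^sub>E I B)"
      by (simp add: emeasure_distr M.emeasure_eq_measure N.emeasure_eq_measure)
  next
    show "range (\<lambda>_::nat. space (PiM I (\<lambda>_. borel :: 'e measure))) \<subseteq> prod_algebra I (\<lambda>_. borel)"
      using I by (auto simp: space_PiM intro!: prod_algebraI_finite)
    show "emeasure (distr M (PiM I (\<lambda>_. borel)) (\<lambda>x. \<lambda>i\<in>I. X i x)) (space (PiM I (\<lambda>_. borel))) \<noteq> \<infinity>"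
      by (simp add: emeasure_distr M.emeasure_eq_measure)
  qed simp_all
qed

section \<open>Independence from factorizing characteristic functions\<close>

lemma (in prob_space) distr_Pair_if_char_factor:
  fixes X :: "'a \<Rightarrow> 'e :: euclidean_space" and Y :: "'a \<Rightarrow> 'f :: euclidean_space"
  assumes [measurable]: "X \<in> borel_measurable M" "Y \<in> borel_measurable M"
    and eq: "\<And>u v. (\<integral>x. cis (u \<bullet> X x + v \<bullet> Y x) \<partial>M) = (\<integral>x. cis (u \<bullet> X x) \<partial>M) * (\<integral>x. cis (v \<bullet> Y x) \<partial>M)"
  shows "distr M (borel \<Otimes>\<^sub>M borel) (\<lambda>x. (X x, Y x)) = distr M borel X \<Otimes>\<^sub>M distr M borel Y"
proof -
  interpret DX: prob_space "distr M borel X" by (rule prob_space_distr) simp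
  interpret DY: prob_space "distr M borel Y" by (rule prob_space_distr) simp
  interpret P: pair_prob_space "distr M borel X" "distr M borel Y" ..
  have s: "sets (distr M borel X \<Otimes>\<^sub>M distr M borel Y) = sets (borel :: ('e \<times> 'f) measure)"
    by (subst borel_prod[symmetric]) (auto intro!: sets_pair_measure_cong)
  have [measurable]: "(\<lambda>x. x) \<in> borel_measurable (distr M borel X \<Otimes>\<^sub>M distr M borel Y)"
    using s by (simp add: measurable_def sets_eq_imp_space_eq[OF s])
  have "distr (distr M borel X \<Otimes>\<^sub>M distr M borel Y) borel (\<lambda>x. x) = distr M borel (\<lambda>x. (X x, Y x))"
  proof (rule finite_measure_eq_if_char_eq)
    fix c :: "'e \<times> 'f"
    obtain u v where c: "c = (u, v)" by fastforce
    have "(\<integral>x. cis (c \<bullet> x) \<partial>(distr M borel X \<Otimes>\<^sub>M distr M borel Y))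
       = (\<integral>x. (\<integral>y. cis (c \<bullet> (x, y)) \<partial>distr M borel Y) \<partial>distr M borel X)"
      by (rule P.integral_fst'[symmetric]) (rule P.integrable_cis; measurable)
    also have "\<dots> = (\<integral>x. cis (u \<bullet> x) * (\<integral>y. cis (v \<bullet> y) \<partial>distr M borel Y) \<partial>distr M borel X)"
      by (simp add: c cis_mult[symmetric])
    also have "\<dots> = (\<integral>x. cis (u \<bullet> X x) \<partial>M) * (\<integral>y. cis (v \<bullet> Y y) \<partial>M)"
      by (simp add: integral_distr)
    also have "\<dots> = (\<integral>x. cis (c \<bullet> (X x, Y x)) \<partial>M)"
      by (simp add: c eq)
    finally show "(\<integral>x. cis (c \<bullet> x) \<partial>(distr M borel X \<Otimes>\<^sub>M distr M borel Y)) = (\<integral>x. cis (c \<bullet> (X x, Y x)) \<partial>M)" .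
  qed (auto intro: P.finite_measure_axioms finite_measure_axioms)
  also have "distr (distr M borel X \<Otimes>\<^sub>M distr M borel Y) borel (\<lambda>x. x) = distr M borel X \<Otimes>\<^sub>M distr M borel Y"
    using s by (intro distr_id2) simp
  finally show ?thesis
    by (simp add: borel_prod)
qed

lemma (in prob_space) indep_vars_if_char_factor:
  fixes X :: "'i \<Rightarrow> 'a \<Rightarrow> 'e :: euclidean_space"
  assumes I: "finite I" "I \<noteq> {}"
    and X: "\<And>i. i \<in> I \<Longrightarrow> X i \<in> borel_measurable M"
    and eq: "\<And>c. (\<integral>x. cis (\<Sum>i\<in>I. c i \<bullet> X i x) \<partial>M) = (\<Prod>i\<in>I. \<integral>x. cis (c i \<bullet> X i x) \<partial>M)"
  shows "indep_vars (\<lambda>_. borel) X I"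
proof -
  \<comment> \<open>The point mass outside \<open>I\<close> makes every component a probability
    measure, as \<open>product_prob_space\<close> demands of all indices.\<close>
  define D where "D i = (if i \<in> I then distr M borel (X i) else return borel 0)" for i
  have prD: "prob_space (D i)" for i
    using X by (auto simp: D_def intro!: prob_space_distr prob_space_return)
  interpret D: product_prob_space D I
    using prD by (simp add: product_prob_space_def product_prob_space_axioms_def product_sigma_finite_def prob_space_imp_sigma_finite)
  interpret FD: finite_product_prob_space D I
    using I by unfold_locales
  have setsD[measurable_cong]: "sets (D i) = sets borel" for i
    by (simp add: D_def)
  have s: "sets (PiM I D) = sets (PiM I (\<lambda>_. borel))"
    by (intro sets_PiM_cong) (auto simp: setsD)
  have "distr M (PiM I (\<lambda>_. borel)) (\<lambda>x. \<lambda>i\<in>I. X i x) = distr (PiM I D) (PiM I (\<lambda>_. borel)) (\<lambda>x. \<lambda>i\<in>I. x i)"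
  proof (rule distr_PiM_eq_if_char_eq)
    show "finite_measure (PiM I D)" by (rule D.P.finite_measure_axioms)
    show "finite_measure M" by (rule finite_measure_axioms)
    show "finite I" by fact
    show "X i \<in> borel_measurable M" if "i \<in> I" for i by (rule X[OF that])
    show "(\<lambda>x. x i) \<in> borel_measurable (PiM I D)" if "i \<in> I" for i
      using that by measurable
    fix c :: "'i \<Rightarrow> 'e"
    have "(\<integral>x. cis (\<Sum>i\<in>I. c i \<bullet> x i) \<partial>PiM I D) = (\<integral>x. (\<Prod>i\<in>I. cis (c i \<bullet> x i)) \<partial>PiM I D)"
      by (simp add: cis_sum)
    also have "\<dots> = (\<Prod>i\<in>I. \<integral>x. cis (c i \<bullet> x) \<partial>D i)"
      using I prD by (intro D.product_integral_prod finite_measure.integrable_cis prob_space.finite_measure) (auto simp: measurable_cong_sets[OF setsD])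
    also have "\<dots> = (\<Prod>i\<in>I. \<integral>x. cis (c i \<bullet> X i x) \<partial>M)"
      using X by (intro prod.cong refl) (auto simp: D_def integral_distr)
    finally show "(\<integral>x. cis (\<Sum>i\<in>I. c i \<bullet> X i x) \<partial>M) = (\<integral>x. cis (\<Sum>i\<in>I. c i \<bullet> x i) \<partial>PiM I D)"
      by (simp add: eq)
  qed
  also have "\<dots> = distr (PiM I D) (PiM I D) (\<lambda>x. x)"
    by (intro distr_cong) (auto simp: s space_PiM PiE_iff extensional_def)
  also have "\<dots> = PiM I D"
    by (rule distr_id)
  also have "PiM I D = PiM I (\<lambda>i. distr M borel (X i))"
    by (intro PiM_cong) (auto simp: D_def)
  finally show ?thesis
    using I X by (subst indep_vars_iff_distr_eq_PiM') auto
qed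

section \<open>Characteristic functions of centered normal variables\<close>

lemma (in prob_space) char_normal_density:
  assumes X: "distributed M lborel X (normal_density 0 \<sigma>)" and \<sigma>: "\<sigma> > 0"
  shows "(\<integral>x. cis (t * X x) \<partial>M) = of_real (exp (- ((\<sigma> * t)\<^sup>2) / 2))"
proof -
  have 1: "distributed M lborel (\<lambda>x. X x / \<sigma>) std_normal_density"
    using X \<sigma> normal_standard_normal_convert[of \<sigma> X 0] by simp
  have "X \<in> measurable M lborel" using X by (rule distributed_measurable)
  then have [measurable]: "X \<in> borel_measurable M" by simp
  have "(\<integral>x. cis (t * X x) \<partial>M) = (\<integral>x. cis (\<sigma> * t * (X x / \<sigma>)) \<partial>M)"
    using \<sigma> by simp
  also have "\<dots> = (\<integral>x. cis (\<sigma> * t * x) \<partial>distr M lborel (\<lambda>x. X x / \<sigma>))"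
    by (subst integral_distr) auto
  also have "\<dots> = char std_normal_distribution (\<sigma> * t)"
    using 1 by (simp add: distributed_def char_def cis_conv_exp)
  finally show ?thesis
    by (simp add: char_std_normal_distribution)
qed

lemma (in prob_space) distributed_normal_if_char:
  assumes [measurable]: "X \<in> borel_measurable M" and \<sigma>: "\<sigma> > 0"
    and ch: "\<And>t. (\<integral>x. cis (t * X x) \<partial>M) = of_real (exp (- ((\<sigma> * t)\<^sup>2) / 2))"
  shows "distributed M lborel X (normal_density 0 \<sigma>)"
proof -
  have 1: "real_distribution (distr M borel (\<lambda>x. X x / \<sigma>))"
    by (rule real_distribution_distr) simp
  have "char (distr M borel (\<lambda>x. X x / \<sigma>)) = char std_normal_distribution"
  proof
    fix t
    have "char (distr M borel (\<lambda>x. X x / \<sigma>)) t = (\<integral>x. cis ((t / \<sigma>) * X x) \<partial>M)"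
      unfolding char_def by (subst integral_distr) (auto simp: cis_conv_exp)
    then show "char (distr M borel (\<lambda>x. X x / \<sigma>)) t = char std_normal_distribution t"
      using \<sigma> by (simp only: ch) (simp add: char_std_normal_distribution)
  qed
  from Levy_uniqueness[OF 1 real_dist_normal_dist this]
  have "distr M lborel (\<lambda>x. X x / \<sigma>) = std_normal_distribution"
    by (simp cong: distr_cong)
  then have "distributed M lborel (\<lambda>x. X x / \<sigma>) std_normal_density"
    by (simp add: distributed_def)
  then show ?thesis
    using \<sigma> normal_standard_normal_convert[of \<sigma> X 0] by simp
qed

section \<open>The characteristic function of the GOE\<close>

lemma borel_measurable_vecI:
  fixes f :: "'a \<Rightarrow> ('b :: euclidean_space) ^ 'n"
  assumes "\<And>i. (\<lambda>x. f x $ i) \<in> borel_measurable M"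
  shows "f \<in> borel_measurable M"
proof (subst borel_measurable_euclidean_space, rule ballI)
  fix b :: "'b ^ 'n" assume "b \<in> Basis"
  then obtain i u where b: "b = axis i u" by (auto simp: Basis_vec_def)
  show "(\<lambda>x. f x \<bullet> b) \<in> borel_measurable M"
    using assms[of i] unfolding b inner_axis by measurable
qed

lemma borel_measurable_vec_nth' [measurable (raw)]:
  fixes f :: "'a \<Rightarrow> ('b :: euclidean_space) ^ 'n"
  assumes "f \<in> borel_measurable M"
  shows "(\<lambda>x. f x $ i) \<in> borel_measurable M"
  by (rule measurable_compose[OF assms borel_measurable_continuous_onI])
    (intro continuous_on_component continuous_on_id)

lemma borel_measurable_matrix_vector_mult [measurable (raw)]:
  fixes A :: "'a \<Rightarrow> real ^ 'n ^ 'm"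
  assumes [measurable]: "A \<in> borel_measurable M" "f \<in> borel_measurable M"
  shows "(\<lambda>x. A x *v f x) \<in> borel_measurable M"
  by (rule borel_measurable_vecI) (simp add: matrix_vector_mult_def)

text \<open>Folding onto the pairs i \<le> j is needed because only these entries of a GOE matrix
  are independent; an off-diagonal entry collects the coefficients of both of its positions.\<close>

lemma sum_matrix_upper_triangle:
  fixes G :: "'n :: finite \<Rightarrow> 'n \<Rightarrow> 'b :: comm_monoid_add"
  assumes e: "bij_betw e {1..CARD('n)} (UNIV :: 'n set)"
  shows "(\<Sum>a\<in>UNIV. \<Sum>b\<in>UNIV. G a b) =
    (\<Sum>(i, j)\<in>{(i, j). 1 \<le> i \<and> i \<le> j \<and> j \<le> CARD('n)}.
       if i = j then G (e i) (e i) else G (e i) (e j) + G (e j) (e i))"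
proof -
  let ?N = "{1..CARD('n)}"
  define P where "P = ?N \<times> ?N"
  define U where "U = {(i, j). 1 \<le> i \<and> i \<le> j \<and> j \<le> CARD('n)}"
  define S where "S = {(i, j). 1 \<le> i \<and> i < j \<and> j \<le> CARD('n)}"
  define L where "L = {(i, j). 1 \<le> j \<and> j < i \<and> i \<le> CARD('n)}"
  have [simp]: "finite P" by (simp add: P_def)
  have UP: "U \<subseteq> P" "L \<subseteq> P" "S \<subseteq> P" by (auto simp: P_def U_def L_def S_def)
  then have fin [simp]: "finite U" "finite L" "finite S" by (auto intro: finite_subset)
  have "(\<Sum>a\<in>UNIV. \<Sum>b\<in>UNIV. G a b) = (\<Sum>i\<in>?N. \<Sum>b\<in>UNIV. G (e i) b)"
    by (rule sum.reindex_bij_betw[OF e, where g="\<lambda>a. sum (G a) UNIV", symmetric])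
  also have "\<dots> = (\<Sum>i\<in>?N. \<Sum>j\<in>?N. G (e i) (e j))"
    by (intro sum.cong refl sum.reindex_bij_betw[OF e, symmetric])
  also have "\<dots> = (\<Sum>(i, j)\<in>P. G (e i) (e j))"
    by (simp add: P_def sum.cartesian_product)
  also have "P = U \<union> L" by (auto simp: P_def U_def L_def)
  also have "(\<Sum>(i, j)\<in>U \<union> L. G (e i) (e j)) = (\<Sum>(i, j)\<in>U. G (e i) (e j)) + (\<Sum>(i, j)\<in>L. G (e i) (e j))"
    by (rule sum.union_disjoint[OF fin(1,2)]) (auto simp: U_def L_def)
  also have "(\<Sum>(i, j)\<in>L. G (e i) (e j)) = (\<Sum>(i, j)\<in>S. G (e j) (e i))"
    by (rule sum.reindex_bij_witness[where i="\<lambda>(i, j). (j, i)" and j="\<lambda>(i, j). (j, i)"]) (auto simp: S_def L_def)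
  also have "\<dots> = (\<Sum>(i, j)\<in>U. if i = j then 0 else G (e j) (e i))"
    by (rule sum.mono_neutral_cong_left[OF fin(1)]) (auto simp: S_def U_def split: if_splits)
  also have "(\<Sum>(i, j)\<in>U. G (e i) (e j)) + (\<Sum>(i, j)\<in>U. if i = j then 0 else G (e j) (e i))
     = (\<Sum>(i, j)\<in>U. if i = j then G (e i) (e i) else G (e i) (e j) + G (e j) (e i))"
    by (simp only: sum.distrib[symmetric], intro sum.cong) auto
  finally show ?thesis by (simp add: U_def)
qed

lemma symmetric_matrix_nth: "B $ a $ b = B $ b $ a" if "transpose B = B"
  by (subst that[symmetric]) (simp add: transpose_def)

lemma GOE_borel_measurable:
  fixes e :: "nat \<Rightarrow> 'n :: finite"
  assumes G: "two_iid_GOE M e A A'" and e: "bij_betw e {1..CARD('n)} UNIV"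
  shows "A \<in> borel_measurable M" "A' \<in> borel_measurable M"
proof -
  have sym: "A \<omega> $ a $ b = A \<omega> $ b $ a" "A' \<omega> $ a $ b = A' \<omega> $ b $ a" if "\<omega> \<in> space M" for \<omega> a b
    using G that by (auto simp: two_iid_GOE_def intro!: symmetric_matrix_nth)
  have m: "(\<lambda>\<omega>. (if b then A' \<omega> else A \<omega>) $ e i $ e j) \<in> borel_measurable M"
    if "1 \<le> i" "i \<le> j" "j \<le> CARD('n)" for b i j
  proof -
    have "distributed M lborel (\<lambda>\<omega>. (if b then A' \<omega> else A \<omega>) $ e i $ e j)
          (normal_density 0 (if i = j then sqrt (2 / real CARD('n)) else sqrt (1 / real CARD('n))))"
      using G that unfolding two_iid_GOE_def by blast
    from distributed_measurable[OF this] show ?thesis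
      by (simp only: measurable_lborel1)
  qed
  have "(\<lambda>\<omega>. (if b then A' \<omega> else A \<omega>) $ x $ y) \<in> borel_measurable M" for b x y
  proof -
    have "x \<in> e ` {1..CARD('n)}" "y \<in> e ` {1..CARD('n)}"
      by (simp_all only: bij_betw_imp_surj_on[OF e] UNIV_I)
    then obtain i j where ij: "x = e i" "y = e j" "i \<in> {1..CARD('n)}" "j \<in> {1..CARD('n)}"
      by blast
    show ?thesis
    proof (cases "i \<le> j")
      case True
      then show ?thesis using ij m by auto
    next
      case False
      then have "(\<lambda>\<omega>. (if b then A' \<omega> else A \<omega>) $ y $ x) \<in> borel_measurable M"
        using ij m[of j i b] by auto
      then show ?thesis
        by (rule measurable_cong[THEN iffD1, rotated]) (auto simp: sym)
    qed
  qed
  from this[of False] this[of True] show "A \<in> borel_measurable M" "A' \<in> borel_measurable M"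
    by (auto intro!: borel_measurable_vecI)
qed

lemma (in prob_space) char_sum_indep_normal:
  assumes K: "finite K" and ind: "indep_vars (\<lambda>_. borel) X K"
    and X: "\<And>k. k \<in> K \<Longrightarrow> 0 < \<sigma> k \<and> distributed M lborel (X k) (normal_density 0 (\<sigma> k))"
  shows "(\<integral>\<omega>. cis (\<Sum>k\<in>K. c k * X k \<omega>) \<partial>M) = of_real (exp (- (\<Sum>k\<in>K. (\<sigma> k * c k)\<^sup>2) / 2))"
proof -
  have "(\<integral>\<omega>. cis (\<Sum>k\<in>K. c k * X k \<omega>) \<partial>M) = (\<Prod>k\<in>K. \<integral>\<omega>. cis (c k * X k \<omega>) \<partial>M)"
    unfolding cis_sum
  proof (rule indep_vars_lebesgue_integral)
    show "indep_vars (\<lambda>_. borel) (\<lambda>k \<omega>. cis (c k * X k \<omega>)) K"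
      by (rule indep_vars_compose2[OF ind, where Y="\<lambda>k x. cis (c k * x)"]) simp
    show "integrable M (\<lambda>\<omega>. cis (c k * X k \<omega>))" if "k \<in> K" for k
    proof -
      have [measurable]: "X k \<in> borel_measurable M"
        using ind that by (auto simp: indep_vars_def)
      show ?thesis by (rule integrable_cis) measurable
    qed
  qed (use K in auto)
  also have "\<dots> = (\<Prod>k\<in>K. of_real (exp (- ((\<sigma> k * c k)\<^sup>2) / 2)))"
    using X by (intro prod.cong refl char_normal_density) auto
  also have "\<dots> = of_real (exp (\<Sum>k\<in>K. - ((\<sigma> k * c k)\<^sup>2) / 2))"
    using K by (simp add: exp_sum)
  finally show ?thesis
    by (simp add: sum_negf sum_divide_distrib)
qed

text \<open>A linear functional of a symmetric matrix sees only the symmetric part of its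
  coefficients. The variances 2/n and 1/n give \<open>U \<bullet> A\<close> the variance
  \<open>(norm (U + transpose U))\<^sup>2 / (2 * n)\<close>, a formula free of coordinates; this
  rotation invariance later permits arbitrary directions \<open>q\<close>.\<close>

lemma GOE_char:
  fixes e :: "nat \<Rightarrow> 'n :: finite" and U V :: "real ^ 'n ^ 'n"
  assumes M: "prob_space M" and G: "two_iid_GOE M e A A'" and e: "bij_betw e {1..CARD('n)} UNIV"
  shows "(\<integral>\<omega>. cis (U \<bullet> A \<omega> + V \<bullet> A' \<omega>) \<partial>M) =
    of_real (exp (- (((norm (U + transpose U))\<^sup>2 + (norm (V + transpose V))\<^sup>2) / (4 * real CARD('n)))))"
proof -
  interpret prob_space M by fact
  let ?n = "real CARD('n)"
  define T where "T = {(i, j). 1 \<le> i \<and> i \<le> j \<and> j \<le> CARD('n)}"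
  define K where "K = (UNIV :: bool set) \<times> T"
  define X where "X = (\<lambda>(b, i, j) \<omega>. (if b then A' \<omega> else A \<omega>) $ e i $ e j)"
  define \<sigma> where "\<sigma> = (\<lambda>(b :: bool, i :: nat, j). if i = j then sqrt (2 / ?n) else sqrt (1 / ?n))"
  define co where "co W = (\<lambda>(i, j). if i = j then W $ e i $ e i else W $ e i $ e j + W $ e j $ e i)" for W :: "real ^ 'n ^ 'n"
  define c where "c = (\<lambda>(b, k). co (if b then V else U) k)"
  have "T \<subseteq> {1..CARD('n)} \<times> {1..CARD('n)}" by (auto simp: T_def)
  then have T[simp]: "finite T" by (rule finite_subset) simp
  then have K: "finite K" by (simp add: K_def)
  have sumK: "(\<Sum>k\<in>K. g k) = (\<Sum>k\<in>T. g (False, k)) + (\<Sum>k\<in>T. g (True, k))" for g :: "_ \<Rightarrow> real"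
    unfolding K_def by (simp add: UNIV_bool sum.cartesian_product' sum.distrib)
  have inner: "(\<Sum>k\<in>T. co W k * (\<lambda>(i, j). B $ e i $ e j) k) = W \<bullet> B" if "transpose B = B" for W B
  proof -
    have B: "B $ a $ b = B $ b $ a" for a b
      using that by (rule symmetric_matrix_nth)
    have "W \<bullet> B = (\<Sum>a\<in>UNIV. \<Sum>b\<in>UNIV. W $ a $ b * B $ a $ b)"
      by (simp add: inner_vec_def)
    also have "\<dots> = (\<Sum>k\<in>T. co W k * (\<lambda>(i, j). B $ e i $ e j) k)"
      unfolding T_def by (subst sum_matrix_upper_triangle[OF e], intro sum.cong refl)
        (auto simp: co_def distrib_right B)
    finally show ?thesis by simp
  qed
  have \<sigma>2: "(\<sigma> (b, i, j))\<^sup>2 = (if i = j then 2 / ?n else 1 / ?n)" for b i j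
    by (simp add: \<sigma>_def)
  have sq: "(\<Sum>k\<in>T. (\<sigma> (b, k) * co W k)\<^sup>2) = (norm (W + transpose W))\<^sup>2 / (2 * ?n)" for W b
  proof -
    have "(norm (W + transpose W))\<^sup>2 = (\<Sum>a\<in>UNIV. \<Sum>b\<in>UNIV. (W $ a $ b + W $ b $ a)\<^sup>2)"
      by (simp add: power2_norm_eq_inner) (simp add: inner_vec_def transpose_def power2_eq_square)
    also have "\<dots> = (\<Sum>k\<in>T. (2 * ?n) * (\<sigma> (b, k) * co W k)\<^sup>2)"
      unfolding T_def by (subst sum_matrix_upper_triangle[OF e], intro sum.cong refl)
        (auto simp: co_def \<sigma>2 power_mult_distrib, auto simp: power2_eq_square algebra_simps)
    finally show ?thesis
      by (simp add: sum_distrib_left[symmetric])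
  qed
  have "(\<integral>\<omega>. cis (U \<bullet> A \<omega> + V \<bullet> A' \<omega>) \<partial>M) = (\<integral>\<omega>. cis (\<Sum>k\<in>K. c k * X k \<omega>) \<partial>M)"
  proof (intro Bochner_Integration.integral_cong refl arg_cong[where f=cis])
    fix \<omega> assume "\<omega> \<in> space M"
    then have "transpose (A \<omega>) = A \<omega>" "transpose (A' \<omega>) = A' \<omega>"
      using G by (auto simp: two_iid_GOE_def)
    from inner[OF this(1), of U] inner[OF this(2), of V]
    show "U \<bullet> A \<omega> + V \<bullet> A' \<omega> = (\<Sum>k\<in>K. c k * X k \<omega>)"
      unfolding sumK by (simp add: c_def X_def case_prod_beta)
  qed
  also have "\<dots> = of_real (exp (- (\<Sum>k\<in>K. (\<sigma> k * c k)\<^sup>2) / 2))"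
  proof (rule char_sum_indep_normal[OF K])
    show "indep_vars (\<lambda>_. borel) X K"
      using G unfolding two_iid_GOE_def X_def K_def T_def by blast
    fix k assume "k \<in> K"
    then obtain b i j where k: "k = (b, i, j)" "1 \<le> i" "i \<le> j" "j \<le> CARD('n)"
      by (auto simp: K_def T_def)
    then have "distributed M lborel (\<lambda>\<omega>. (if b then A' \<omega> else A \<omega>) $ e i $ e j)
          (normal_density 0 (if i = j then sqrt (2 / real CARD('n)) else sqrt (1 / real CARD('n))))"
      using G unfolding two_iid_GOE_def by blast
    then show "0 < \<sigma> k \<and> distributed M lborel (X k) (normal_density 0 (\<sigma> k))"
      by (auto simp: k \<sigma>_def X_def)
  qed
  also have "(\<Sum>k\<in>K. (\<sigma> k * c k)\<^sup>2) = ((norm (U + transpose U))\<^sup>2 + (norm (V + transpose V))\<^sup>2) / (2 * ?n)"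
    unfolding sumK by (simp add: c_def sq add_divide_distrib)
  finally show ?thesis
    by simp
qed

section \<open>One step of the coupling with a deterministic orthogonal family\<close>

definition orthogonal_upto :: "nat \<Rightarrow> (nat \<Rightarrow> real ^ 'n) \<Rightarrow> bool" where
  "orthogonal_upto k q \<longleftrightarrow> (\<forall>s\<in>{1..k}. \<forall>t\<in>{1..k}. q s \<bullet> q t = (if s = t then real CARD('n) else 0))"

text \<open>For orthogonal \<open>q 1\<close>, ..., \<open>q k\<close> of squared norm n this is the
  projection onto their orthogonal complement. The index is shifted: \<open>residual k\<close> is
  the remainder formed in \<open>gs_next (Suc k)\<close>.\<close>

definition residual :: "nat \<Rightarrow> (nat \<Rightarrow> real ^ 'n) \<Rightarrow> real ^ 'n \<Rightarrow> real ^ 'n" where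
  "residual k q u = u - (\<Sum>s\<in>{1..k}. ((1 / real CARD('n)) * (q s \<bullet> u)) *\<^sub>R q s)"

lemma orthogonal_uptoD:
  fixes q :: "nat \<Rightarrow> real ^ 'n"
  assumes "orthogonal_upto k q" "s \<in> {1..k}" "t \<in> {1..k}"
  shows "q s \<bullet> q t = (if s = t then real CARD('n) else 0)"
  using assms unfolding orthogonal_upto_def by blast

lemma orthogonal_upto_mono: "orthogonal_upto k q \<Longrightarrow> j \<le> k \<Longrightarrow> orthogonal_upto j q"
  by (auto simp: orthogonal_upto_def)

text \<open>\<open>k\<close> bounds the orthogonal family, \<open>r\<close> the directions projected
  away. Keeping them apart covers the directions with r < s \<le> k, which are orthogonal to the
  subtracted sum; \<open>z_next_deflate\<close> relies on this.\<close>

lemma inner_residual: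
  fixes q :: "nat \<Rightarrow> real ^ 'n"
  assumes q: "orthogonal_upto k q" and s: "s \<in> {1..k}" "r \<le> k"
  shows "q s \<bullet> residual r q u = (if s \<le> r then 0 else q s \<bullet> u)"
proof -
  have "q s \<bullet> residual r q u = q s \<bullet> u - (\<Sum>j\<in>{1..r}. (1 / real CARD('n)) * (q j \<bullet> u) * (q s \<bullet> q j))"
    by (simp add: residual_def inner_diff_right inner_sum_right)
  also have "(\<Sum>j\<in>{1..r}. (1 / real CARD('n)) * (q j \<bullet> u) * (q s \<bullet> q j)) =
      (\<Sum>j\<in>{1..r}. if j = s then q s \<bullet> u else 0)"
    using s by (intro sum.cong refl) (auto simp: orthogonal_uptoD[OF q])
  also have "\<dots> = (if s \<le> r then q s \<bullet> u else 0)"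
    using s by auto
  finally show ?thesis by simp
qed

lemma residual_orthogonal_self:
  assumes q: "orthogonal_upto k q" and "t \<in> {1..k}" "r < t"
  shows "residual r q (q t) = q t"
proof -
  have "(\<Sum>s\<in>{1..r}. ((1 / real CARD('n)) * (q s \<bullet> q t)) *\<^sub>R q s) = (\<Sum>s\<in>{1..r}. 0)"
    using assms by (intro sum.cong refl) (auto simp: orthogonal_uptoD[OF q])
  then show ?thesis by (simp add: residual_def)
qed

lemma in_span_iff_residual:
  fixes q :: "nat \<Rightarrow> real ^ 'n"
  assumes q: "orthogonal_upto k q"
  shows "u \<in> span (q ` {1..k}) \<longleftrightarrow> residual k q u = 0"
proof
  have sp: "(\<Sum>s\<in>{1..k}. ((1 / real CARD('n)) * (q s \<bullet> u)) *\<^sub>R q s) \<in> span (q ` {1..k})"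
    by (intro span_sum span_scale span_base) auto
  {
    assume "u \<in> span (q ` {1..k})"
    then have r: "residual k q u \<in> span (q ` {1..k})"
      unfolding residual_def using sp by (rule span_diff)
    have "orthogonal (residual k q u) (residual k q u)"
    proof (rule orthogonal_to_span[OF r])
      fix y assume "y \<in> q ` {1..k}"
      then show "orthogonal (residual k q u) y"
        using inner_residual[OF q _ order_refl, of _ u] by (auto simp: orthogonal_def inner_commute)
    qed
    then show "residual k q u = 0" by (simp add: orthogonal_def)
  next
    assume "residual k q u = 0"
    then have "u = (\<Sum>s\<in>{1..k}. ((1 / real CARD('n)) * (q s \<bullet> u)) *\<^sub>R q s)"
      by (simp add: residual_def)
    then show "u \<in> span (q ` {1..k})"
      using sp by simp
  }
qed

text \<open>A dimension count; it guarantees that the \<open>LEAST\<close> in the fallback branch of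
  \<open>gs_next\<close> finds an index.\<close>

lemma ex_basis_notin_span:
  fixes v q :: "nat \<Rightarrow> real ^ 'n"
  assumes v: "span (v ` {1..CARD('n)}) = UNIV" and k: "k < CARD('n)"
  shows "\<exists>j. j \<in> {1..CARD('n)} \<and> v j \<notin> span (q ` {1..k})"
proof (rule ccontr)
  assume "\<not> ?thesis"
  then have "v ` {1..CARD('n)} \<subseteq> span (q ` {1..k})" by auto
  then have "UNIV \<subseteq> span (q ` {1..k})"
    using span_minimal[of "v ` {1..CARD('n)}" "span (q ` {1..k})"] v by simp
  then have "dim (UNIV :: (real ^ 'n) set) \<le> dim (span (q ` {1..k}))"
    by (rule dim_subset)
  also have "dim (span (q ` {1..k})) = dim (q ` {1..k})" by (rule dim_span)
  also have "\<dots> \<le> card (q ` {1..k})" by (rule dim_le_card') simp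
  also have "\<dots> \<le> k" using card_image_le[of "{1..k}" q] by simp
  finally show False using k by (simp add: dim_UNIV)
qed

text \<open>On an orthogonal family, membership in the span can be tested by the residual,
  which makes the branch taken by \<open>gs_next\<close> measurable.\<close>

lemma gs_next_residual:
  fixes q v :: "nat \<Rightarrow> real ^ 'n"
  assumes q: "orthogonal_upto k q"
  shows "gs_next (Suc k) v q x =
    (let u = (if residual k q x \<noteq> 0 then x
               else v (LEAST j. j \<in> {1..CARD('n)} \<and> residual k q (v j) \<noteq> 0));
         r = residual k q u
     in (sqrt (real CARD('n)) / norm r) *\<^sub>R r)"
proof -
  have "y \<notin> span (q ` {1..k}) \<longleftrightarrow> residual k q y \<noteq> 0" for y
    using in_span_iff_residual[OF q, of y] by blast
  then show ?thesis
    by (simp only: gs_next_def Let_def atLeastLessThanSuc_atLeastAtMost residual_def)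
qed

lemma gs_next_orthogonal:
  fixes q v :: "nat \<Rightarrow> real ^ 'n"
  assumes q: "orthogonal_upto k q" and v: "span (v ` {1..CARD('n)}) = UNIV" and k: "k < CARD('n)"
    and qk: "q (Suc k) = gs_next (Suc k) v q x"
  shows "orthogonal_upto (Suc k) q"
proof -
  define u where "u = (if residual k q x \<noteq> 0 then x
               else v (LEAST j. j \<in> {1..CARD('n)} \<and> residual k q (v j) \<noteq> 0))"
  have ex: "\<exists>j. j \<in> {1..CARD('n)} \<and> residual k q (v j) \<noteq> 0"
    using ex_basis_notin_span[OF v k, of q] unfolding in_span_iff_residual[OF q] .
  \<comment> \<open>In either branch the residual is nonzero, so the normalization does not divide
    by zero.\<close>
  have r: "residual k q u \<noteq> 0"
    using LeastI_ex[OF ex] by (auto simp: u_def)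
  have eq: "q (Suc k) = (sqrt (real CARD('n)) / norm (residual k q u)) *\<^sub>R residual k q u"
    unfolding qk gs_next_residual[OF q] Let_def u_def ..
  have 1: "q s \<bullet> q (Suc k) = 0" if "s \<in> {1..k}" for s
    unfolding eq using inner_residual[OF q that order_refl, of u] that by simp
  have 2: "q (Suc k) \<bullet> q (Suc k) = real CARD('n)"
    unfolding eq using r by (simp add: power2_norm_eq_inner[symmetric] power2_eq_square field_simps)
  show ?thesis
    unfolding orthogonal_upto_def
  proof (intro ballI)
    fix s t assume st: "s \<in> {1..Suc k}" "t \<in> {1..Suc k}"
    consider "s \<in> {1..k}" "t \<in> {1..k}" | "s = Suc k" "t = Suc k"
      | "s = Suc k" "t \<in> {1..k}" | "t = Suc k" "s \<in> {1..k}"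
      using st by force
    then show "q s \<bullet> q t = (if s = t then real CARD('n) else 0)"
      by cases (use orthogonal_uptoD[OF q, of s t] 1[of s] 1[of t] 2 inner_commute[of "q s" "q t"] in auto)
  qed
qed

section \<open>Rank one matrices and symmetrized norms\<close>

definition outer :: "real ^ 'm \<Rightarrow> real ^ 'n \<Rightarrow> real ^ 'n ^ 'm" where
  "outer u w = (\<chi> i j. u $ i * w $ j)"

lemma inner_outer: "outer u w \<bullet> A = u \<bullet> (A *v w)"
  by (simp add: outer_def inner_vec_def matrix_vector_mult_def sum_distrib_left mult_ac)

lemma outer_mult_vec: "outer a b *v w = (b \<bullet> w) *\<^sub>R a"
  by (simp add: vec_eq_iff outer_def matrix_vector_mult_def inner_vec_def sum_distrib_left sum_distrib_right mult_ac)

lemma transpose_outer: "transpose (outer u w) = outer w u"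
  by (simp add: outer_def transpose_def vec_eq_iff mult.commute)

lemma inner_transpose: "transpose A \<bullet> transpose B = A \<bullet> (B :: real ^ 'n ^ 'm)"
  unfolding inner_vec_def transpose_def by simp (rule sum.swap)

lemma transpose_add: "transpose (A + B) = transpose A + transpose (B :: real ^ 'n ^ 'm)"
  by (simp add: transpose_def vec_eq_iff)

text \<open>This is the quantity in the exponent of \<open>GOE_char\<close> for a rank one
  coefficient. The last term doubles the variance of a quadratic form, which the averaging with
  \<open>A'\<close> in \<open>z_next\<close> offsets.\<close>

lemma norm_symmetrized_outer:
  "(norm (outer u w + transpose (outer u w)))\<^sup>2 = 2 * (u \<bullet> u) * (w \<bullet> w) + 2 * (u \<bullet> w)\<^sup>2"
  unfolding power2_norm_eq_inner
  by (simp add: transpose_outer inner_add inner_outer outer_mult_vec inner_commute power2_eq_square)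

lemma inner_matrix_mult_left: "G \<bullet> (B ** A) = (transpose B ** G) \<bullet> (A :: real ^ 'n ^ 'm)"
proof -
  have "G \<bullet> (B ** A) = (\<Sum>i\<in>UNIV. \<Sum>j\<in>UNIV. \<Sum>k\<in>UNIV. B $ i $ k * G $ i $ j * A $ k $ j)"
    by (simp add: inner_vec_def matrix_matrix_mult_def sum_distrib_left mult_ac)
  also have "\<dots> = (\<Sum>i\<in>UNIV. \<Sum>k\<in>UNIV. \<Sum>j\<in>UNIV. B $ i $ k * G $ i $ j * A $ k $ j)"
    by (intro sum.cong refl sum.swap)
  also have "\<dots> = (\<Sum>k\<in>UNIV. \<Sum>i\<in>UNIV. \<Sum>j\<in>UNIV. B $ i $ k * G $ i $ j * A $ k $ j)"
    by (rule sum.swap)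
  also have "\<dots> = (\<Sum>k\<in>UNIV. \<Sum>j\<in>UNIV. \<Sum>i\<in>UNIV. B $ i $ k * G $ i $ j * A $ k $ j)"
    by (intro sum.cong refl sum.swap)
  also have "\<dots> = (transpose B ** G) \<bullet> A"
    by (simp add: inner_vec_def matrix_matrix_mult_def transpose_def sum_distrib_right)
  finally show ?thesis .
qed

lemma inner_matrix_mult_right: "G \<bullet> (A ** B) = (G ** transpose B) \<bullet> (A :: real ^ 'n ^ 'm)"
  using inner_matrix_mult_left[of "transpose G" "transpose B" "transpose A"]
  by (simp add: matrix_transpose_mul[symmetric] inner_transpose)
    (metis inner_transpose matrix_transpose_mul transpose_transpose)

section \<open>Deflation: the data untouched by the first steps\<close>

definition proj_perp :: "nat \<Rightarrow> (nat \<Rightarrow> real ^ 'n) \<Rightarrow> real ^ 'n ^ 'n" where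
  "proj_perp r q = mat 1 - (\<Sum>s\<in>{1..r}. (1 / real CARD('n)) *\<^sub>R outer (q s) (q s))"

lemma proj_perp_mult_vec: "proj_perp r q *v u = residual r q u"
  for q :: "nat \<Rightarrow> real ^ 'n"
proof -
  have s: "(\<Sum>s\<in>S. c *\<^sub>R outer (q s) (q s)) *v u = (\<Sum>s\<in>S. (c * (q s \<bullet> u)) *\<^sub>R q s)" for S u c
    by (induction S rule: infinite_finite_induct)
      (simp_all add: matrix_vector_mult_add_rdistrib scaleR_matrix_vector_assoc[symmetric] outer_mult_vec)
  show ?thesis
    by (simp add: proj_perp_def residual_def matrix_vector_mult_diff_rdistrib s)
qed

lemma transpose_proj_perp: "transpose (proj_perp r q) = proj_perp r q"
  by (simp add: proj_perp_def transpose_def vec_eq_iff mat_def outer_def mult.commute)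

text \<open>Both sides are compressed because for symmetric \<open>A\<close> the images
  \<open>A *v q s\<close> fix the rows as well as the columns in the directions
  \<open>q s\<close>.\<close>

definition deflate :: "nat \<Rightarrow> (nat \<Rightarrow> real ^ 'n) \<Rightarrow> real ^ 'n ^ 'n \<Rightarrow> real ^ 'n ^ 'n" where
  "deflate r q A = proj_perp r q ** A ** proj_perp r q"

lemma deflate_mult_vec: "deflate r q A *v u = residual r q (A *v residual r q u)"
  by (simp add: deflate_def matrix_vector_mul_assoc[symmetric] proj_perp_mult_vec)

lemma transpose_deflate: "transpose (deflate r q A) = deflate r q (transpose A)"
  by (simp add: deflate_def matrix_transpose_mul transpose_proj_perp matrix_mul_assoc)

lemma inner_deflate: "G \<bullet> deflate r q A = deflate r q G \<bullet> A"
  unfolding deflate_def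
  by (subst inner_matrix_mult_right, subst inner_matrix_mult_left) (simp add: transpose_proj_perp matrix_mul_assoc)

text \<open>Steps 1 to \<open>r\<close> read entries of \<open>A'\<close> in the leading block only.
  Zeroing that block, instead of restricting the index set, keeps the matrix type.\<close>

definition hide_block :: "(nat \<Rightarrow> 'n) \<Rightarrow> nat \<Rightarrow> real ^ 'n ^ 'n \<Rightarrow> real ^ 'n ^ 'n" where
  "hide_block e r B = (\<chi> i j. if i \<in> e ` {1..r} \<and> j \<in> e ` {1..r} then 0 else B $ i $ j)"

lemma transpose_hide_block: "transpose (hide_block e r B) = hide_block e r (transpose B)"
  by (auto simp: hide_block_def transpose_def vec_eq_iff)

lemma inner_hide_block: "G \<bullet> hide_block e r B = hide_block e r G \<bullet> B"
  unfolding inner_vec_def hide_block_def by (intro sum.cong refl) (auto intro!: sum.cong)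

text \<open>For r < t the direction \<open>q t\<close> is orthogonal to \<open>q 1\<close>, ...,
  \<open>q r\<close>, so deflation merely strips from \<open>A *v q t\<close> its components along
  them, and the correction terms strip the same components anyway. The column \<open>e t\<close> of
  \<open>A'\<close> lies outside the hidden block.\<close>

lemma z_next_deflate:
  fixes q :: "nat \<Rightarrow> real ^ 'n"
  assumes q: "orthogonal_upto t q" and e: "inj_on e {1..CARD('n)}"
    and t: "r < t" "t \<le> CARD('n)"
  shows "z_next t e (deflate r q A) (hide_block e r A') q = z_next t e A A' q"
proof -
  define a where "a s = (1 / real CARD('n)) * (q s \<bullet> (A *v q t))" for s
  have rt: "residual r q (q t) = q t"
    using t by (intro residual_orthogonal_self[OF q]) auto
  have D: "deflate r q A *v q t = A *v q t - (\<Sum>s\<in>{1..r}. a s *\<^sub>R q s)"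
    by (simp add: deflate_mult_vec rt) (simp add: residual_def a_def)
  define a' where "a' s = (1 / real CARD('n)) * (q s \<bullet> (deflate r q A *v q t))" for s
  have I: "a' s = (if s \<le> r then 0 else a s)" if "s \<in> {1..t}" for s
    using that t by (simp add: deflate_mult_vec rt inner_residual[OF q] a_def a'_def)
  have et: "e t \<notin> e ` {1..r}"
    using t by (subst inj_on_image_mem_iff[OF e]) auto
  then have H: "hide_block e r A' $ e s $ e t = A' $ e s $ e t" for s
    by (auto simp: hide_block_def)
  have "(\<Sum>s\<in>{1..<t}. (A' $ e s $ e t - (if s \<le> r then 0 else a s)) *\<^sub>R q s)
     = (\<Sum>s\<in>{1..<t}. (A' $ e s $ e t - a s) *\<^sub>R q s) + (\<Sum>s\<in>{1..<t}. if s \<le> r then a s *\<^sub>R q s else 0)"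
    by (simp only: sum.distrib[symmetric], intro sum.cong refl) (auto simp: algebra_simps)
  also have "(\<Sum>s\<in>{1..<t}. if s \<le> r then a s *\<^sub>R q s else 0) = (\<Sum>s\<in>{1..r}. a s *\<^sub>R q s)"
    using t by (intro sum.mono_neutral_cong_right) auto
  finally have S: "(\<Sum>s\<in>{1..<t}. (A' $ e s $ e t - (if s \<le> r then 0 else a s)) *\<^sub>R q s)
     = (\<Sum>s\<in>{1..<t}. (A' $ e s $ e t - a s) *\<^sub>R q s) + (\<Sum>s\<in>{1..r}. a s *\<^sub>R q s)" .
  have "z_next t e (deflate r q A) (hide_block e r A') q =
     deflate r q A *v q t + ((1 / 2) * (A' $ e t $ e t - (if t \<le> r then 0 else a t))) *\<^sub>R q t
      + (\<Sum>s\<in>{1..<t}. (A' $ e s $ e t - (if s \<le> r then 0 else a s)) *\<^sub>R q s)"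
    unfolding z_next_def H a'_def[symmetric] using t
    by (intro arg_cong2[where f="(+)"] refl sum.cong) (simp_all add: I)
  also have "\<dots> = z_next t e A A' q"
    unfolding S D z_next_def using t by (simp add: a_def)
  finally show ?thesis .
qed

text \<open>As a linear functional of \<open>(A, A')\<close>, \<open>c \<bullet> z\<^sub>t\<close> has the rank one coefficient matrices
  \<open>c' \<otimes> q\<^sub>t\<close> and \<open>d \<otimes> e\<^sub>t\<close> with the following \<open>c'\<close> and \<open>d\<close>.\<close>

definition coeff_A :: "nat \<Rightarrow> (nat \<Rightarrow> real ^ 'n) \<Rightarrow> real ^ 'n \<Rightarrow> real ^ 'n" where
  "coeff_A t q c = c - ((1/2) * ((1 / real CARD('n)) * (c \<bullet> q t))) *\<^sub>R q t
     - (\<Sum>s\<in>{1..<t}. ((1 / real CARD('n)) * (c \<bullet> q s)) *\<^sub>R q s)"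

definition coeff_A' :: "nat \<Rightarrow> (nat \<Rightarrow> 'n) \<Rightarrow> (nat \<Rightarrow> real ^ 'n) \<Rightarrow> real ^ 'n \<Rightarrow> real ^ 'n" where
  "coeff_A' t e q c = ((1/2) * (c \<bullet> q t)) *\<^sub>R axis (e t) 1 + (\<Sum>s\<in>{1..<t}. (c \<bullet> q s) *\<^sub>R axis (e s) 1)"

lemma inner_z_next:
  fixes q :: "nat \<Rightarrow> real ^ 'n" and c :: "real ^ 'n"
  shows "c \<bullet> z_next t e A A' q = outer (coeff_A t q c) (q t) \<bullet> A + outer (coeff_A' t e q c) (axis (e t) 1) \<bullet> A'"
proof -
  have 1: "A' *v axis (e t) 1 = (\<chi> i. A' $ i $ e t)"
    by (simp add: matrix_vector_mul_component inner_axis vec_eq_iff)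
  show ?thesis
    by (simp add: inner_outer z_next_def coeff_A_def coeff_A'_def 1 inner_add_right inner_diff_left inner_add_left inner_sum_right inner_sum_left
      inner_axis' sum.distrib sum_subtractf left_diff_distrib right_diff_distrib mult_ac)
qed

text \<open>The correction terms of \<open>z_next\<close> are tuned so that the variance contributed by \<open>A'\<close>
  compensates exactly the variance lost in \<open>A\<close>.\<close>

lemma variance_z_next:
  fixes q :: "nat \<Rightarrow> real ^ 'n" and c :: "real ^ 'n"
  assumes q: "orthogonal_upto t q" and e: "inj_on e {1..CARD('n)}" and t: "1 \<le> t" "t \<le> CARD('n)"
  shows "(norm (outer (coeff_A t q c) (q t) + transpose (outer (coeff_A t q c) (q t))))\<^sup>2
     + (norm (outer (coeff_A' t e q c) (axis (e t) 1) + transpose (outer (coeff_A' t e q c) (axis (e t) 1))))\<^sup>2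
     = 2 * real CARD('n) * (c \<bullet> c)"
proof -
  define c' where "c' = coeff_A t q c"
  define d where "d = coeff_A' t e q c"
  let ?n = "real CARD('n)"
  \<comment> \<open>One family of coefficients serves both \<open>coeff_A\<close>, scaled by 1/n,
    and \<open>coeff_A'\<close>; only the entry at s = t carries the factor 1/2.\<close>
  define b where "b s = (if s = t then (1/2) * (c \<bullet> q t) else c \<bullet> q s)" for s
  have set: "{1..t} = insert t {1..<t}" using t by auto
  have c': "c' = c - (\<Sum>s\<in>{1..t}. ((1 / ?n) * b s) *\<^sub>R q s)"
    unfolding c'_def coeff_A_def set by (simp add: b_def algebra_simps)
  have d: "d = (\<Sum>s\<in>{1..t}. b s *\<^sub>R axis (e s) 1)"
    unfolding d_def coeff_A'_def set by (simp add: b_def)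
  have axis: "axis (e s) 1 \<bullet> (axis (e u) 1 :: real ^ 'n) = (if s = u then 1 else 0)" if "s \<in> {1..t}" "u \<in> {1..t}" for s u
    using that t inj_onD[OF e, of s u] by (auto simp: inner_axis_axis)
  have dax: "d \<bullet> axis (e s) 1 = b s" if "s \<in> {1..t}" for s
  proof -
    have "d \<bullet> axis (e s) 1 = (\<Sum>u\<in>{1..t}. if u = s then b u else 0)"
      unfolding d inner_sum_left using that by (intro sum.cong refl) (simp add: axis)
    then show ?thesis using that by simp
  qed
  have dd: "d \<bullet> d = (\<Sum>s\<in>{1..t}. (b s)\<^sup>2)"
  proof -
    have "d \<bullet> d = d \<bullet> (\<Sum>s\<in>{1..t}. b s *\<^sub>R axis (e s) 1)" by (simp add: d)
    also have "\<dots> = (\<Sum>s\<in>{1..t}. (b s)\<^sup>2)"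
      unfolding inner_sum_right by (intro sum.cong refl) (simp add: dax power2_eq_square)
    finally show ?thesis .
  qed
  have c'q: "c' \<bullet> q s = c \<bullet> q s - b s" if "s \<in> {1..t}" for s
  proof -
    have "c' \<bullet> q s = c \<bullet> q s - (\<Sum>u\<in>{1..t}. if u = s then b u else 0)"
      unfolding c' inner_diff_left inner_sum_left using that
      by (intro arg_cong2[where f="(-)"] refl sum.cong) (simp add: orthogonal_uptoD[OF q])
    then show ?thesis using that by simp
  qed
  have cc: "c' \<bullet> c' = c \<bullet> c - (1 / ?n) * (\<Sum>s\<in>{1..t}. b s * (2 * (c \<bullet> q s) - b s))"
  proof -
    have "c' \<bullet> c' = c' \<bullet> c - (\<Sum>s\<in>{1..t}. (1 / ?n) * b s * (c' \<bullet> q s))"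
      by (subst (2) c') (simp add: inner_diff_right inner_sum_right)
    also have "\<dots> = c' \<bullet> c - (\<Sum>s\<in>{1..t}. (1 / ?n) * b s * (c \<bullet> q s - b s))"
      by (intro arg_cong2[where f="(-)"] refl sum.cong) (simp add: c'q)
    also have "c' \<bullet> c = c \<bullet> c - (\<Sum>s\<in>{1..t}. (1 / ?n) * b s * (c \<bullet> q s))"
      by (subst inner_commute) (simp add: c' inner_diff_right inner_sum_right)
    finally show ?thesis
      by (simp add: sum_distrib_left algebra_simps sum.distrib[symmetric] sum_subtractf diff_divide_distrib add_divide_distrib)
  qed
  have bt: "b t = (1/2) * (c \<bullet> q t)" by (simp add: b_def)
  have qt: "q t \<bullet> q t = ?n" using t by (simp add: orthogonal_uptoD[OF q])
  \<comment> \<open>For s < t the summand is the square of \<open>b s\<close>; at s = t, where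
    \<open>c \<bullet> q t\<close> is twice \<open>b t\<close>, it is three times the
    square.\<close>
  have "(\<Sum>s\<in>{1..t}. b s * (2 * (c \<bullet> q s) - b s)) = (\<Sum>s\<in>{1..t}. (b s)\<^sup>2) + 2 * (b t)\<^sup>2"
    unfolding set by (simp add: b_def power2_eq_square algebra_simps)
  then have cc2: "c' \<bullet> c' = c \<bullet> c - (1 / ?n) * ((\<Sum>s\<in>{1..t}. (b s)\<^sup>2) + 2 * (b t)\<^sup>2)"
    unfolding cc by simp
  have ct: "c' \<bullet> q t = b t" using t by (simp add: c'q bt)
  have n0: "?n > 0" by simp
  \<comment> \<open>After multiplication by 2n, \<open>cc2\<close> shows a loss of twice the sum of
    all squares of \<open>b\<close> plus four times the square of \<open>b t\<close>. The term
    \<open>d \<bullet> d\<close> restores the first part, the two squared inner products the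
    second.\<close>
  have "(norm (outer c' (q t) + transpose (outer c' (q t))))\<^sup>2
     + (norm (outer d (axis (e t) 1) + transpose (outer d (axis (e t) 1))))\<^sup>2
     = 2 * (c' \<bullet> c') * ?n + 2 * (b t)\<^sup>2 + (2 * (d \<bullet> d) + 2 * (b t)\<^sup>2)"
    unfolding norm_symmetrized_outer qt ct using t by (simp add: axis dax)
  also have "\<dots> = 2 * ?n * (c \<bullet> c)"
    unfolding cc2 dd using n0 by (simp add: field_simps)
  finally show ?thesis
    unfolding c'_def d_def .
qed

text \<open>Orthogonality is needed between the symmetrized matrices, hence the condition on the
  transpose. Additivity in the Gaussian exponent is what becomes independence.\<close>

lemma norm_symmetrized_add:
  fixes X W :: "real ^ 'n ^ 'n"
  assumes "X \<bullet> W = 0" "X \<bullet> transpose W = 0"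
  shows "(norm (X + W + transpose (X + W)))\<^sup>2 = (norm (X + transpose X))\<^sup>2 + (norm (W + transpose W))\<^sup>2"
proof -
  have "transpose X \<bullet> transpose W = 0" "transpose X \<bullet> W = 0"
    using assms inner_transpose[of X W] inner_transpose[of X "transpose W"] by simp_all
  then have "(X + transpose X) \<bullet> (W + transpose W) = 0"
    using assms by (simp add: inner_add)
  then have "(norm ((X + transpose X) + (W + transpose W)))\<^sup>2 = (norm (X + transpose X))\<^sup>2 + (norm (W + transpose W))\<^sup>2"
    by (intro norm_add_Pythagorean) (simp add: orthogonal_def)
  then show ?thesis by (simp add: transpose_add add_ac)
qed

text \<open>Deflation annihilates \<open>q t\<close> for t \<le> r: this decorrelates the
  \<open>A\<close>-part of \<open>z_next\<close> from the deflated matrix.\<close>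

lemma outer_inner_deflate:
  fixes q :: "nat \<Rightarrow> real ^ 'n"
  assumes q: "orthogonal_upto r q" and t: "t \<in> {1..r}"
  shows "outer c (q t) \<bullet> deflate r q G = 0"
proof -
  have "q t \<in> span (q ` {1..r})" using t by (intro span_base) auto
  then have "residual r q (q t) = 0" using in_span_iff_residual[OF q] by blast
  then show ?thesis by (simp add: inner_outer deflate_mult_vec) (simp add: residual_def)
qed

text \<open>The coefficients with which \<open>A'\<close> enters \<open>z_next\<close> are supported
  in the leading block; this is the corresponding decorrelation for \<open>A'\<close>.\<close>

lemma hide_block_outer:
  assumes t: "t \<in> {1..r}"
  shows "hide_block e r (outer (coeff_A' t e q c) (axis (e t) 1)) = 0"
proof -
  have "coeff_A' t e q c $ i = 0" if "i \<notin> e ` {1..r}" for i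
  proof -
    have "axis (e s) (1::real) $ i = 0" if "s \<in> {1..t}" for s
      using \<open>i \<notin> _\<close> that t by (auto simp: axis_def)
    then show ?thesis using t by (auto simp: coeff_A'_def intro!: sum.neutral)
  qed
  then show ?thesis using t
    by (auto simp: hide_block_def outer_def vec_eq_iff axis_def)
qed

lemma borel_measurable_z_next:
  fixes A A' :: "'a \<Rightarrow> real ^ 'n ^ 'n"
  assumes [measurable]: "A \<in> borel_measurable M" "A' \<in> borel_measurable M"
    and q: "\<And>s. s \<in> {1..t} \<Longrightarrow> (\<lambda>\<omega>. q \<omega> s) \<in> borel_measurable M" and t: "1 \<le> t"
  shows "(\<lambda>\<omega>. z_next t e (A \<omega>) (A' \<omega>) (q \<omega>)) \<in> borel_measurable M"
proof -
  have [measurable]: "(\<lambda>\<omega>. q \<omega> t) \<in> borel_measurable M" using q t by auto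
  have [measurable]: "(\<lambda>\<omega>. q \<omega> s) \<in> borel_measurable M" if "s \<in> {1..<t}" for s using q that by auto
  show ?thesis unfolding z_next_def by measurable
qed

lemma borel_measurable_deflate [measurable (raw)]:
  assumes [measurable]: "A \<in> borel_measurable M"
  shows "(\<lambda>\<omega>. deflate r q (A \<omega>)) \<in> borel_measurable M"
  unfolding deflate_def matrix_matrix_mult_def by (intro borel_measurable_vecI) simp

lemma borel_measurable_hide_block [measurable (raw)]:
  assumes [measurable]: "A \<in> borel_measurable M"
  shows "(\<lambda>\<omega>. hide_block e r (A \<omega>)) \<in> borel_measurable M"
  unfolding hide_block_def by (intro borel_measurable_vecI) simp

text \<open>The coefficients of \<open>z_next\<close> are orthogonal, also after transposition, to
  all deflated and hidden ones, so the exponents in \<open>GOE_char\<close> add up;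
  \<open>variance_z_next\<close> contributes 2n|c|^2 / (4n) = |c|^2 / 2. Law and independence come
  out of the same formula.\<close>

lemma z_next_char:
  fixes e :: "nat \<Rightarrow> 'n :: finite"
  assumes M: "prob_space M" and G: "two_iid_GOE M e A A'" and e: "bij_betw e {1..CARD('n)} UNIV"
    and q: "orthogonal_upto t q" and t: "1 \<le> t" "t \<le> CARD('n)"
  shows "(\<integral>\<omega>. cis (c \<bullet> z_next t e (A \<omega>) (A' \<omega>) q + (U \<bullet> deflate t q (A \<omega>) + V \<bullet> hide_block e t (A' \<omega>))) \<partial>M)
   = of_real (exp (- ((c \<bullet> c) / 2))) * (\<integral>\<omega>. cis (U \<bullet> deflate t q (A \<omega>) + V \<bullet> hide_block e t (A' \<omega>)) \<partial>M)"
proof -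
  let ?n = "real CARD('n)"
  let ?X = "outer (coeff_A t q c) (q t)" and ?Y = "outer (coeff_A' t e q c) (axis (e t) 1)"
  let ?N = "\<lambda>W :: real ^ 'n ^ 'n. (norm (W + transpose W))\<^sup>2"
  have 1: "?N (?X + deflate t q U) = ?N ?X + ?N (deflate t q U)"
    using t by (intro norm_symmetrized_add) (auto simp: transpose_deflate intro!: outer_inner_deflate q)
  have 2: "?N (?Y + hide_block e t V) = ?N ?Y + ?N (hide_block e t V)"
  proof (rule norm_symmetrized_add)
    show "?Y \<bullet> hide_block e t V = 0" "?Y \<bullet> transpose (hide_block e t V) = 0"
      using hide_block_outer[of t t e q c] t by (simp_all add: transpose_hide_block inner_hide_block)
  qed
  have 3: "?N ?X + ?N ?Y = 2 * ?n * (c \<bullet> c)"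
    by (rule variance_z_next[OF q bij_betw_imp_inj_on[OF e] t])
  have "(\<integral>\<omega>. cis (c \<bullet> z_next t e (A \<omega>) (A' \<omega>) q + (U \<bullet> deflate t q (A \<omega>) + V \<bullet> hide_block e t (A' \<omega>))) \<partial>M)
      = (\<integral>\<omega>. cis ((?X + deflate t q U) \<bullet> A \<omega> + (?Y + hide_block e t V) \<bullet> A' \<omega>) \<partial>M)"
    by (simp add: inner_z_next inner_add_left inner_deflate inner_hide_block add_ac)
  also have "\<dots> = of_real (exp (- ((?N (?X + deflate t q U) + ?N (?Y + hide_block e t V)) / (4 * ?n))))"
    by (rule GOE_char[OF M G e])
  also have "(?N (?X + deflate t q U) + ?N (?Y + hide_block e t V)) / (4 * ?n)
      = (2 * ?n * (c \<bullet> c) + (?N (deflate t q U) + ?N (hide_block e t V))) / (4 * ?n)"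
    unfolding 1 2 3[symmetric] by (simp add: add_ac)
  also have "\<dots> = (c \<bullet> c) / 2 + (?N (deflate t q U) + ?N (hide_block e t V)) / (4 * ?n)"
    by (simp add: add_divide_distrib)
  also have "of_real (exp (- \<dots>)) = of_real (exp (- ((c \<bullet> c) / 2)))
      * complex_of_real (exp (- ((?N (deflate t q U) + ?N (hide_block e t V)) / (4 * ?n))))"
    by (simp add: exp_add[symmetric] flip: of_real_mult)
  also have "complex_of_real (exp (- ((?N (deflate t q U) + ?N (hide_block e t V)) / (4 * ?n))))
      = (\<integral>\<omega>. cis (deflate t q U \<bullet> A \<omega> + hide_block e t V \<bullet> A' \<omega>) \<partial>M)"
    by (rule GOE_char[OF M G e, symmetric])
  finally show ?thesis
    by (simp add: inner_deflate inner_hide_block)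
qed

lemma z_next_char':
  fixes e :: "nat \<Rightarrow> 'n :: finite"
  assumes M: "prob_space M" and G: "two_iid_GOE M e A A'" and e: "bij_betw e {1..CARD('n)} UNIV"
    and q: "orthogonal_upto t q" and t: "1 \<le> t" "t \<le> CARD('n)"
  shows "(\<integral>\<omega>. cis (c \<bullet> z_next t e (A \<omega>) (A' \<omega>) q) \<partial>M) = of_real (exp (- ((c \<bullet> c) / 2)))"
  using z_next_char[OF assms, of c 0 0] prob_space.prob_space[OF M] by simp

text \<open>Conditionally on the past, \<open>z\<^sub>t\<close> is independent of everything that the later steps can read off from \<open>(A, A')\<close>.\<close>

lemma distr_z_next_deflated:
  fixes e :: "nat \<Rightarrow> 'n :: finite"
  assumes M: "prob_space M" and G: "two_iid_GOE M e A A'" and e: "bij_betw e {1..CARD('n)} UNIV"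
    and q: "orthogonal_upto t q" and t: "1 \<le> t" "t \<le> CARD('n)"
  defines "z \<equiv> \<lambda>\<omega>. z_next t e (A \<omega>) (A' \<omega>) q" and "Y \<equiv> \<lambda>\<omega>. (deflate t q (A \<omega>), hide_block e t (A' \<omega>))"
  shows "distr M (borel \<Otimes>\<^sub>M borel) (\<lambda>\<omega>. (z \<omega>, Y \<omega>)) = distr M borel z \<Otimes>\<^sub>M distr M borel Y"
proof (rule prob_space.distr_Pair_if_char_factor[OF M])
  note [measurable] = GOE_borel_measurable[OF G e]
  show "z \<in> borel_measurable M"
    unfolding z_def by (rule borel_measurable_z_next) (use t in auto)
  show "Y \<in> borel_measurable M"
    unfolding Y_def borel_prod[symmetric] by measurable
  fix c and W :: "(real ^ 'n ^ 'n) \<times> (real ^ 'n ^ 'n)"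
  show "(\<integral>\<omega>. cis (c \<bullet> z \<omega> + W \<bullet> Y \<omega>) \<partial>M) = (\<integral>\<omega>. cis (c \<bullet> z \<omega>) \<partial>M) * (\<integral>\<omega>. cis (W \<bullet> Y \<omega>) \<partial>M)"
    unfolding z_def Y_def inner_prod_def fst_conv snd_conv z_next_char'[OF M G e q t]
    by (rule z_next_char[OF M G e q t])
qed

section \<open>Adaptive strategies\<close>

lemma z_next_cong:
  assumes "\<And>s. s \<in> {1..t} \<Longrightarrow> q s = q' s" "1 \<le> t"
  shows "z_next t e A A' q = z_next t e A A' q'"
  using assms unfolding z_next_def by (intro arg_cong2[where f="(+)"] sum.cong) auto

lemma deflate_cong:
  assumes "\<And>s. s \<in> {1..r} \<Longrightarrow> q s = q' s"
  shows "deflate r q A = deflate r q' A"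
proof -
  have "proj_perp r q = proj_perp r q'"
    unfolding proj_perp_def using assms by (intro arg_cong2[where f="(-)"] sum.cong) auto
  then show ?thesis by (simp add: deflate_def)
qed

text \<open>\<open>Q h t\<close> is the direction \<open>q t\<close> as a function of the values
  \<open>h s\<close> of the earlier \<open>z s\<close>; in the application it absorbs
  \<open>f\<close>, \<open>m\<close>, \<open>Omega\<close> and \<open>v\<close>. Orthogonality is
  required for every \<open>h\<close>, not just almost surely, because histories are frozen to
  arbitrary values.\<close>

locale strategy =
  fixes Q :: "(nat \<Rightarrow> real ^ 'n) \<Rightarrow> nat \<Rightarrow> real ^ 'n" and T :: nat and e :: "nat \<Rightarrow> 'n"
  assumes e_bij: "bij_betw e {1..CARD('n)} UNIV"
    and T_le: "T \<le> CARD('n)"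
    and orthogonal: "orthogonal_upto T (Q h)"
    and causal: "t \<in> {1..T} \<Longrightarrow> (\<And>s. s \<in> {1..<t} \<Longrightarrow> h s = h' s) \<Longrightarrow> Q h t = Q h' t"
    and measurable_Q: "t \<in> {1..T} \<Longrightarrow> (\<lambda>h. Q h t) \<in> borel_measurable (PiM UNIV (\<lambda>_. borel))"
begin

text \<open>\<open>run h t\<^sub>0 (A, A') s\<close> is \<open>z\<^sub>s\<close> when the first \<open>t\<^sub>0 - 1\<close> values are prescribed by the history \<open>h\<close>.\<close>

function run :: "(nat \<Rightarrow> real ^ 'n) \<Rightarrow> nat \<Rightarrow> (real ^ 'n ^ 'n) \<times> (real ^ 'n ^ 'n) \<Rightarrow> nat \<Rightarrow> real ^ 'n" where
  "run h t0 R s = (if s < t0 then h s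
     else z_next s e (fst R) (snd R) (Q (\<lambda>r. if r < s then run h t0 R r else 0)))"
  by pat_completeness auto
termination by (relation "Wellfounded.measure (\<lambda>(h, t0, R, s). s)") auto

declare run.simps [simp del]

lemma run_less [simp]: "s < t0 \<Longrightarrow> run h t0 R s = h s"
  by (simp add: run.simps)

lemma z_next_Q_cong:
  assumes "\<And>s. s \<in> {1..<t} \<Longrightarrow> h s = h' s" "t \<in> {1..T}"
  shows "z_next t e A A' (Q h) = z_next t e A A' (Q h')"
  by (rule z_next_cong) (use assms in \<open>auto intro!: causal\<close>)

text \<open>The cut-off with default 0 inside \<open>run\<close> serves termination; by causality it
  does not affect the directions used.\<close>

lemma run_step:
  assumes "t0 \<le> s" "s \<in> {1..T}"
  shows "run h t0 R s = z_next s e (fst R) (snd R) (Q (run h t0 R))"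
  using assms by (subst run.simps) (auto intro!: z_next_Q_cong)

text \<open>Identities between runs are proved through this: one side is checked to satisfy the
  recursion of the other.\<close>

lemma run_unique:
  assumes "\<And>s. s \<in> {t0..T} \<Longrightarrow> z s = z_next s e (fst R) (snd R) (Q z)"
    and "\<And>s. s \<in> {1..<t0} \<Longrightarrow> z s = h s" and t0: "1 \<le> t0" and s: "s \<in> {1..T}"
  shows "z s = run h t0 R s"
  using s
proof (induction s rule: less_induct)
  case (less s)
  show ?case
  proof (cases "s < t0")
    case False
    then have "z s = z_next s e (fst R) (snd R) (Q z)" using less.prems by (intro assms(1)) simp
    also have "\<dots> = z_next s e (fst R) (snd R) (Q (run h t0 R))"
      using less by (intro z_next_Q_cong) auto
    finally show ?thesis using False less.prems by (simp add: run_step)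
  next
    case True
    then have "z s = h s" using less.prems by (intro assms(2)) simp
    then show ?thesis using True by simp
  qed
qed

lemma run_Suc:
  assumes t: "t \<in> {1..T}" and s: "s \<in> {1..T}"
  shows "run h t R s = run (h(t := z_next t e (fst R) (snd R) (Q h))) (Suc t) R s"
proof (rule run_unique)
  fix s assume s: "s \<in> {Suc t..T}"
  show "run h t R s = z_next s e (fst R) (snd R) (Q (run h t R))"
    using s t by (intro run_step) auto
next
  fix s assume s: "s \<in> {1..<Suc t}"
  show "run h t R s = (h(t := z_next t e (fst R) (snd R) (Q h))) s"
  proof (cases "s = t")
    case True
    have "run h t R t = z_next t e (fst R) (snd R) (Q (run h t R))"
      using t by (intro run_step) auto
    also have "\<dots> = z_next t e (fst R) (snd R) (Q h)"
      using t by (intro z_next_Q_cong) auto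
    finally show ?thesis using True by simp
  qed (use s in auto)
qed (use t s in auto)

text \<open>With the first \<open>t\<close> values frozen, \<open>q 1\<close>, ...,
  \<open>q t\<close> are fixed, so \<open>z_next_deflate\<close> applies at each later step. A
  separate \<open>q\<close> is allowed because the deflation will be taken from a history that may
  differ from \<open>h\<close> at time \<open>t\<close>, which does not influence these
  directions.\<close>

lemma run_deflate:
  assumes t: "t \<in> {1..T}" and s: "s \<in> {1..T}" and q: "\<And>r. r \<in> {1..t} \<Longrightarrow> q r = Q h r"
  shows "run h (Suc t) (deflate t q A, hide_block e t A') s = run h (Suc t) (A, A') s"
proof (rule run_unique)
  fix s assume s: "s \<in> {Suc t..T}"
  define z where "z = run h (Suc t) (deflate t q A, hide_block e t A')"
  have "q r = Q z r" if "r \<in> {1..t}" for r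
    unfolding q[OF that] using that t by (intro causal) (auto simp: z_def)
  then have d: "deflate t q A = deflate t (Q z) A"
    by (rule deflate_cong)
  have "z s = z_next s e (deflate t q A) (hide_block e t A') (Q z)"
    unfolding z_def using s t by (subst run_step) auto
  also have "\<dots> = z_next s e A A' (Q z)"
    unfolding d using s T_le orthogonal_upto_mono[OF orthogonal] bij_betw_imp_inj_on[OF e_bij]
    by (intro z_next_deflate) auto
  finally show "run h (Suc t) (deflate t q A, hide_block e t A') s =
      z_next s e (fst (A, A')) (snd (A, A')) (Q (run h (Suc t) (deflate t q A, hide_block e t A')))"
    by (simp add: z_def)
qed (use s in auto)

lemma borel_measurable_run:
  assumes A: "A \<in> borel_measurable N" "A' \<in> borel_measurable N"
    and h: "\<And>s. (\<lambda>\<omega>. h \<omega> s) \<in> borel_measurable N" and t0: "1 \<le> t0" and s: "s \<le> T"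
  shows "(\<lambda>\<omega>. run (h \<omega>) t0 (A \<omega>, A' \<omega>) s) \<in> borel_measurable N"
  using s
proof (induction s rule: less_induct)
  case (less s)
  show ?case
  proof (cases "s < t0")
    case False
    have H: "(\<lambda>\<omega> r. if r < s then run (h \<omega>) t0 (A \<omega>, A' \<omega>) r else 0) \<in> measurable N (PiM UNIV (\<lambda>_. borel))"
    proof (rule measurable_PiM_single')
      fix r :: nat
      show "(\<lambda>\<omega>. if r < s then run (h \<omega>) t0 (A \<omega>, A' \<omega>) r else 0) \<in> borel_measurable N"
        using less by (cases "r < s") auto
    qed auto
    have "(\<lambda>\<omega>. z_next s e (A \<omega>) (A' \<omega>) (Q (\<lambda>r. if r < s then run (h \<omega>) t0 (A \<omega>, A' \<omega>) r else 0))) \<in> borel_measurable N"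
    proof (rule borel_measurable_z_next[OF A])
      fix r assume "r \<in> {1..s}"
      then have "r \<in> {1..T}" using less.prems by auto
      from measurable_compose[OF H measurable_Q[OF this]]
      show "(\<lambda>\<omega>. Q (\<lambda>r. if r < s then run (h \<omega>) t0 (A \<omega>, A' \<omega>) r else 0) r) \<in> borel_measurable N" .
    qed (use False t0 in auto)
    then show ?thesis using False by (subst run.simps) simp
  qed (use h in simp)
qed

text \<open>The history is generalized because the induction step replaces \<open>h\<close> by
  \<open>h(t := x)\<close>. The induction starts at \<open>t = Suc T\<close>, where the product is
  empty.\<close>

lemma emeasure_run:
  fixes \<gamma> :: "(real ^ 'n) measure"
  assumes M: "prob_space M" and G: "two_iid_GOE M e A A'"
    and \<gamma>: "prob_space \<gamma>" "sets \<gamma> = sets borel" "\<And>c. (\<integral>x. cis (c \<bullet> x) \<partial>\<gamma>) = of_real (exp (- ((c \<bullet> c) / 2)))"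
    and B: "\<And>s. s \<in> {1..T} \<Longrightarrow> B s \<in> sets borel" and t: "1 \<le> t" "t \<le> Suc T"
  shows "emeasure M {\<omega> \<in> space M. \<forall>s\<in>{t..T}. run h t (A \<omega>, A' \<omega>) s \<in> B s} = (\<Prod>s\<in>{t..T}. emeasure \<gamma> (B s))"
  using t(2,1)
proof (induction t arbitrary: h rule: inc_induct)
  case base
  then show ?case using prob_space.emeasure_space_1[OF M] by simp
next
  case (step t)
  note [measurable] = GOE_borel_measurable[OF G e_bij]
  have t: "t \<in> {1..T}" using step by auto
  define z where "z = (\<lambda>\<omega>. z_next t e (A \<omega>) (A' \<omega>) (Q h))"
  define Y where "Y = (\<lambda>\<omega>. (deflate t (Q h) (A \<omega>), hide_block e t (A' \<omega>)))"
  have orth: "orthogonal_upto t (Q h)"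
    using orthogonal_upto_mono[OF orthogonal, of t] t by auto
  have tn: "1 \<le> t" "t \<le> CARD('n)" using t T_le by auto
  have [measurable]: "z \<in> borel_measurable M"
    unfolding z_def by (rule borel_measurable_z_next) (use t in auto)
  have [measurable]: "Y \<in> borel_measurable M"
    unfolding Y_def borel_prod[symmetric] by measurable
  have [measurable]: "B s \<in> sets borel" if "s \<in> {t..T}" for s using B that t by auto
  have [measurable]: "B t \<in> sets borel" using B t by auto
  have fs [measurable]: "fst \<in> borel_measurable (borel :: ((real ^ 'n ^ 'n) \<times> (real ^ 'n ^ 'n)) measure)"
    "snd \<in> borel_measurable (borel :: ((real ^ 'n ^ 'n) \<times> (real ^ 'n ^ 'n)) measure)"
    by (simp_all add: borel_prod[symmetric])
  \<comment> \<open>The section of \<open>S\<close> at a point x of \<open>B t\<close> is the event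
    that the remaining run, with x appended to the history, hits its targets.\<close>
  define S where "S = {p \<in> space (borel \<Otimes>\<^sub>M borel). fst p \<in> B t \<and>
     (\<forall>s\<in>{Suc t..T}. run (h(t := fst p)) (Suc t) (fst (snd p), snd (snd p)) s \<in> B s)}"
  have [measurable]: "(\<lambda>p. run (h(t := fst p)) (Suc t) (fst (snd p), snd (snd p)) s)
      \<in> borel_measurable (borel \<Otimes>\<^sub>M (borel :: ((real ^ 'n ^ 'n) \<times> (real ^ 'n ^ 'n)) measure))" if "s \<in> {Suc t..T}" for s
  proof (rule borel_measurable_run)
    show "(\<lambda>p. (h(t := fst p)) r) \<in> borel_measurable (borel \<Otimes>\<^sub>M (borel :: ((real ^ 'n ^ 'n) \<times> (real ^ 'n ^ 'n)) measure))" for r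
      by (cases "r = t") auto
  qed (use that in \<open>auto intro: measurable_compose[OF measurable_snd fs(1)] measurable_compose[OF measurable_snd fs(2)]\<close>)
  have S [measurable]: "S \<in> sets (borel \<Otimes>\<^sub>M borel)"
    unfolding S_def by measurable
  \<comment> \<open>Used twice: with the random value \<open>z\<close> to write the event through
    \<open>(z, Y)\<close>, and with a fixed value to return to \<open>(A, A')\<close> for the
    induction hypothesis.\<close>
  have ev: "run h' (Suc t) (Y \<omega>) s = run h' (Suc t) (A \<omega>, A' \<omega>) s"
    if h': "\<And>r. r < t \<Longrightarrow> h' r = h r" and s: "s \<in> {Suc t..T}" for h' \<omega> s
    unfolding Y_def
  proof (rule run_deflate[OF t])
    show "Q h r = Q h' r" if "r \<in> {1..t}" for r
      using that t h' by (intro causal) auto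
  qed (use s in auto)
  interpret Y: prob_space "distr M borel Y" by (rule prob_space.prob_space_distr[OF M]) simp
  have "{\<omega> \<in> space M. \<forall>s\<in>{t..T}. run h t (A \<omega>, A' \<omega>) s \<in> B s} = (\<lambda>\<omega>. (z \<omega>, Y \<omega>)) -` S \<inter> space M"
  proof -
    have "(\<forall>s\<in>{t..T}. run h t (A \<omega>, A' \<omega>) s \<in> B s) \<longleftrightarrow> (z \<omega>, Y \<omega>) \<in> S" for \<omega>
    proof -
      have 1: "run h t (A \<omega>, A' \<omega>) s = run (h(t := z \<omega>)) (Suc t) (A \<omega>, A' \<omega>) s" if "s \<in> {t..T}" for s
        using run_Suc[OF t, of s h "(A \<omega>, A' \<omega>)"] that t by (simp add: z_def)
      have 2: "run (h(t := z \<omega>)) (Suc t) (A \<omega>, A' \<omega>) s = run (h(t := z \<omega>)) (Suc t) (Y \<omega>) s" if "s \<in> {Suc t..T}" for s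
        using that by (intro ev[symmetric]) auto
      have "{t..T} = insert t {Suc t..T}" using t by auto
      then show ?thesis
        using 1 2 by (auto simp: S_def space_pair_measure)
    qed
    then show ?thesis by auto
  qed
  then have "emeasure M {\<omega> \<in> space M. \<forall>s\<in>{t..T}. run h t (A \<omega>, A' \<omega>) s \<in> B s}
      = emeasure (distr M (borel \<Otimes>\<^sub>M borel) (\<lambda>\<omega>. (z \<omega>, Y \<omega>))) S"
    by (simp add: emeasure_distr)
  \<comment> \<open>Independence of \<open>z\<close> and \<open>Y\<close> enters here and turns the
    joint law into a product to which Fubini applies.\<close>
  also have "\<dots> = emeasure (distr M borel z \<Otimes>\<^sub>M distr M borel Y) S"
    unfolding z_def Y_def by (simp only: distr_z_next_deflated[OF M G e_bij orth tn])
  also have "\<dots> = (\<integral>\<^sup>+x. emeasure (distr M borel Y) (Pair x -` S) \<partial>distr M borel z)"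
    by (rule Y.emeasure_pair_measure_alt) (use S in \<open>simp cong: sets_pair_measure_cong\<close>)
  also have "\<dots> = (\<integral>\<^sup>+x. (\<Prod>s\<in>{Suc t..T}. emeasure \<gamma> (B s)) * indicator (B t) x \<partial>distr M borel z)"
  proof (rule nn_integral_cong)
    fix x
    show "emeasure (distr M borel Y) (Pair x -` S) = (\<Prod>s\<in>{Suc t..T}. emeasure \<gamma> (B s)) * indicator (B t) x"
    proof (cases "x \<in> B t")
      case True
      have "emeasure (distr M borel Y) (Pair x -` S) = emeasure M (Y -` (Pair x -` S) \<inter> space M)"
        by (rule emeasure_distr) (simp_all add: sets_Pair1)
      also have "Y -` (Pair x -` S) \<inter> space M = {\<omega> \<in> space M. \<forall>s\<in>{Suc t..T}. run (h(t := x)) (Suc t) (Y \<omega>) s \<in> B s}"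
        using True by (auto simp: S_def space_pair_measure)
      also have "\<dots> = {\<omega> \<in> space M. \<forall>s\<in>{Suc t..T}. run (h(t := x)) (Suc t) (A \<omega>, A' \<omega>) s \<in> B s}"
        using ev[of "h(t := x)"] by auto
      also have "emeasure M \<dots> = (\<Prod>s\<in>{Suc t..T}. emeasure \<gamma> (B s))"
        by (rule step.IH) simp
      finally show ?thesis using True by simp
    next
      case False
      then have "Pair x -` S = {}" by (auto simp: S_def)
      then show ?thesis using False by simp
    qed
  qed
  also have "\<dots> = (\<Prod>s\<in>{Suc t..T}. emeasure \<gamma> (B s)) * emeasure (distr M borel z) (B t)"
    by (rule nn_integral_cmult_indicator) simp
  also have "distr M borel z = distr \<gamma> borel (\<lambda>x. x)"
  proof (rule finite_measure_eq_if_char_eq)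
    show "finite_measure M" "finite_measure \<gamma>" using M \<gamma>(1) by (simp_all add: prob_space.finite_measure)
    show "z \<in> borel_measurable M" by simp
    show "(\<lambda>x. x) \<in> borel_measurable \<gamma>"
      unfolding measurable_cong_sets[OF \<gamma>(2) refl] by simp
    show "(\<integral>x. cis (c \<bullet> z x) \<partial>M) = (\<integral>x. cis (c \<bullet> x) \<partial>\<gamma>)" for c
      unfolding z_def by (simp only: z_next_char'[OF M G e_bij orth tn] \<gamma>(3))
  qed
  also have "distr \<gamma> borel (\<lambda>x. x) = \<gamma>"
    by (rule distr_id2) (simp only: \<gamma>(2))
  also have "(\<Prod>s\<in>{Suc t..T}. emeasure \<gamma> (B s)) * emeasure \<gamma> (B t) = (\<Prod>s\<in>{t..T}. emeasure \<gamma> (B s))"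
  proof -
    have "{t..T} = insert t {Suc t..T}" using t by auto
    then show ?thesis by (simp add: mult.commute)
  qed
  finally show ?case .
qed

end

section \<open>Gaussian processes\<close>

text \<open>Taking all but one \<open>B i\<close> to be the whole space identifies the marginals;
  the assumed formula then says that the joint law is their product.\<close>

lemma (in prob_space) indep_vars_if_emeasure_prod:
  fixes X :: "'i \<Rightarrow> 'a \<Rightarrow> 'e :: second_countable_topology"
  assumes I: "finite I" "I \<noteq> {}"
    and X: "\<And>i. i \<in> I \<Longrightarrow> X i \<in> borel_measurable M"
    and \<gamma>: "prob_space \<gamma>" "sets \<gamma> = sets borel"
    and eq: "\<And>B. (\<And>i. i \<in> I \<Longrightarrow> B i \<in> sets borel) \<Longrightarrow>
        emeasure M {\<omega> \<in> space M. \<forall>i\<in>I. X i \<omega> \<in> B i} = (\<Prod>i\<in>I. emeasure \<gamma> (B i))"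
  shows "indep_vars (\<lambda>_. borel) X I" and "\<And>i. i \<in> I \<Longrightarrow> distr M borel (X i) = \<gamma>"
proof -
  interpret \<gamma>: prob_space \<gamma> by fact
  interpret G: product_sigma_finite "\<lambda>_ :: 'i. \<gamma>" by standard
  have g1: "emeasure \<gamma> UNIV = 1"
    using \<gamma>.emeasure_space_1 sets_eq_imp_space_eq[OF \<gamma>(2)] by simp
  show d: "distr M borel (X i) = \<gamma>" if i: "i \<in> I" for i
  proof (rule measure_eqI)
    fix D assume "D \<in> sets (distr M borel (X i))"
    then have D: "D \<in> sets borel" by simp
    have "emeasure (distr M borel (X i)) D = emeasure M (X i -` D \<inter> space M)"
      using X[OF i] D by (simp add: emeasure_distr)
    also have "X i -` D \<inter> space M = {\<omega> \<in> space M. \<forall>j\<in>I. X j \<omega> \<in> (if j = i then D else UNIV)}"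
      using i by auto
    also have "emeasure M \<dots> = (\<Prod>j\<in>I. emeasure \<gamma> (if j = i then D else UNIV))"
      using D by (intro eq) auto
    also have "\<dots> = (\<Prod>j\<in>I. if j = i then emeasure \<gamma> D else 1)"
      by (intro prod.cong refl) (simp add: g1)
    also have "\<dots> = emeasure \<gamma> D"
      using I i by simp
    finally show "emeasure (distr M borel (X i)) D = emeasure \<gamma> D" .
  qed (simp add: \<gamma>(2))
  have s: "sets (PiM I (\<lambda>_. \<gamma>)) = sets (PiM I (\<lambda>_. borel))"
    by (intro sets_PiM_cong) (auto simp: \<gamma>(2))
  have "distr M (PiM I (\<lambda>_. borel)) (\<lambda>\<omega>. \<lambda>i\<in>I. X i \<omega>) = PiM I (\<lambda>_. \<gamma>)"
  proof (rule G.PiM_eqI)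
    fix B :: "'i \<Rightarrow> 'e set" assume "\<And>i. i \<in> I \<Longrightarrow> B i \<in> sets \<gamma>"
    then have B: "\<And>i. i \<in> I \<Longrightarrow> B i \<in> sets borel" by (simp add: \<gamma>(2))
    have "(\<lambda>\<omega>. \<lambda>i\<in>I. X i \<omega>) -` Pi\<^sub>E I B \<inter> space M = {\<omega> \<in> space M. \<forall>i\<in>I. X i \<omega> \<in> B i}"
      by (auto simp: PiE_iff)
    then show "emeasure (distr M (PiM I (\<lambda>_. borel)) (\<lambda>\<omega>. \<lambda>i\<in>I. X i \<omega>)) (Pi\<^sub>E I B) = (\<Prod>i\<in>I. emeasure \<gamma> (B i))"
      using I X B by (subst emeasure_distr) (auto intro!: sets_PiM_I_finite measurable_restrict eq)
  qed (use I s in auto)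
  also have "\<dots> = PiM I (\<lambda>i. distr M borel (X i))"
    by (intro PiM_cong) (auto simp: d)
  finally show "indep_vars (\<lambda>_. borel) X I"
    using I X by (subst indep_vars_iff_distr_eq_PiM') auto
qed

lemma (in prob_space) normal_second_moment:
  assumes X: "distributed M lborel X (normal_density 0 \<sigma>)" and \<sigma>: "\<sigma> > 0"
  shows "integrable M (\<lambda>\<omega>. (X \<omega>)\<^sup>2)" and "(\<integral>\<omega>. (X \<omega>)\<^sup>2 \<partial>M) = \<sigma>\<^sup>2"
proof -
  show "integrable M (\<lambda>\<omega>. (X \<omega>)\<^sup>2)"
    using distributed_integrable[OF X, of "\<lambda>x. x\<^sup>2"] integrable_normal_moment[OF \<sigma>, of 0 2] by simp
  show "(\<integral>\<omega>. (X \<omega>)\<^sup>2 \<partial>M) = \<sigma>\<^sup>2"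
    using normal_distributed_variance[OF \<sigma> X] normal_distributed_expectation[OF \<sigma> X] by simp
qed

lemma integrable_mult_of_square_integrable:
  fixes f g :: "'a \<Rightarrow> real"
  assumes [measurable]: "f \<in> borel_measurable M" "g \<in> borel_measurable M"
    and "integrable M (\<lambda>x. (f x)\<^sup>2)" "integrable M (\<lambda>x. (g x)\<^sup>2)"
  shows "integrable M (\<lambda>x. f x * g x)"
proof (rule Bochner_Integration.integrable_bound)
  show "integrable M (\<lambda>x. (f x)\<^sup>2 + (g x)\<^sup>2)" using assms by simp
  have "\<bar>a * b\<bar> \<le> a\<^sup>2 + b\<^sup>2" for a b :: real
  proof -
    have "0 \<le> (\<bar>a\<bar> - \<bar>b\<bar>)\<^sup>2" by simp
    then have "2 * \<bar>a * b\<bar> \<le> a\<^sup>2 + b\<^sup>2" by (simp add: power2_diff abs_mult)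
    then show ?thesis using abs_ge_zero[of "a * b"] by linarith
  qed
  then show "AE x in M. norm (f x * g x) \<le> norm ((f x)\<^sup>2 + (g x)\<^sup>2)"
    by (auto intro!: AE_I2)
qed simp

text \<open>This makes the covariance determine the law. Both alternatives of
  \<open>centered_gaussian_family\<close>, almost surely 0 or normal, give a combination L the
  characteristic function exp(-E L^2 / 2), and the covariance gives E L^2.\<close>

lemma (in prob_space) gaussian_process_cov_char:
  fixes w :: "nat \<Rightarrow> 'a \<Rightarrow> real ^ 'n"
  assumes w: "gaussian_process_cov M T Sig w"
  shows "(\<integral>\<omega>. cis (\<Sum>t\<in>{1..T}. c t \<bullet> w t \<omega>) \<partial>M) =
    of_real (exp (- ((\<Sum>s\<in>{1..T}. \<Sum>t\<in>{1..T}. Sig s t * (c s \<bullet> c t)) / 2)))"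
proof -
  define I where "I = {1..T} \<times> (UNIV :: 'n set)"
  define X where "X = (\<lambda>(t, i) \<omega>. w t \<omega> $ i)"
  define a where "a = (\<lambda>(t, i). c t $ i)"
  have I: "finite I" by (simp add: I_def)
  have cov: "(\<integral>\<omega>. X (s, i) \<omega> * X (t, j) \<omega> \<partial>M) = (if i = j then Sig s t else 0)"
    if "s \<in> {1..T}" "t \<in> {1..T}" for s t i j
    using w that unfolding gaussian_process_cov_def X_def by auto
  have fam: "centered_gaussian_family M X I"
    using w unfolding gaussian_process_cov_def X_def I_def by simp
  have [measurable]: "X k \<in> borel_measurable M" if "k \<in> I" for k
    using fam that by (auto simp: centered_gaussian_family_def)
  have dich: "(\<integral>\<omega>. cis (\<Sum>k\<in>I. b k * X k \<omega>) \<partial>M) = of_real (exp (- ((\<integral>\<omega>. (\<Sum>k\<in>I. b k * X k \<omega>)\<^sup>2 \<partial>M) / 2)))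
      \<and> integrable M (\<lambda>\<omega>. (\<Sum>k\<in>I. b k * X k \<omega>)\<^sup>2)" for b
  proof -
    let ?L = "\<lambda>\<omega>. \<Sum>k\<in>I. b k * X k \<omega>"
    have [measurable]: "?L \<in> borel_measurable M" by measurable
    consider "AE \<omega> in M. ?L \<omega> = 0"
      | \<sigma> where "\<sigma> > 0" "distributed M lborel ?L (normal_density 0 \<sigma>)"
      using fam unfolding centered_gaussian_family_def by blast
    then show ?thesis
    proof cases
      case 1
      have "(\<integral>\<omega>. cis (?L \<omega>) \<partial>M) = (\<integral>\<omega>. 1 \<partial>M)"
        using 1 by (intro integral_cong_AE) auto
      moreover have "(\<integral>\<omega>. (?L \<omega>)\<^sup>2 \<partial>M) = (\<integral>\<omega>. 0 \<partial>M)"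
        using 1 by (intro integral_cong_AE) auto
      moreover have "integrable M (\<lambda>\<omega>. (?L \<omega>)\<^sup>2) \<longleftrightarrow> integrable M (\<lambda>\<omega>. 0 :: real)"
        using 1 by (intro integrable_cong_AE) auto
      ultimately show ?thesis by (simp add: prob_space)
    next
      case 2
      then show ?thesis
        using char_normal_density[OF 2(2,1), of 1] normal_second_moment[OF 2(2,1)] by simp
    qed
  qed
  \<comment> \<open>The covariance identity alone does not imply integrability of the products; it
    comes from square integrability of single coordinates, a special case of
    \<open>dich\<close>.\<close>
  have sq: "integrable M (\<lambda>\<omega>. (X k \<omega>)\<^sup>2)" if "k \<in> I" for k
  proof -
    have "(\<Sum>l\<in>I. (if l = k then 1 else 0) * X l \<omega>) = X k \<omega>" for \<omega>
      using I that by (simp add: if_distrib[where f="\<lambda>x. x * _"] cong: if_cong)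
    then show ?thesis using dich[of "\<lambda>l. if l = k then 1 else 0"] by simp
  qed
  have prod: "integrable M (\<lambda>\<omega>. X k \<omega> * X l \<omega>)" if "k \<in> I" "l \<in> I" for k l
    using that sq by (intro integrable_mult_of_square_integrable) auto
  have "(\<integral>\<omega>. (\<Sum>k\<in>I. a k * X k \<omega>)\<^sup>2 \<partial>M) = (\<integral>\<omega>. (\<Sum>k\<in>I. \<Sum>l\<in>I. a k * a l * (X k \<omega> * X l \<omega>)) \<partial>M)"
    by (simp add: power2_eq_square sum_product mult_ac)
  also have "\<dots> = (\<Sum>k\<in>I. \<Sum>l\<in>I. a k * a l * (\<integral>\<omega>. X k \<omega> * X l \<omega> \<partial>M))"
    using prod by (simp add: Bochner_Integration.integral_sum Bochner_Integration.integrable_sum)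
  also have "\<dots> = (\<Sum>s\<in>{1..T}. \<Sum>i\<in>UNIV. \<Sum>t\<in>{1..T}. \<Sum>j\<in>UNIV. c s $ i * c t $ j * (if i = j then Sig s t else 0))"
    unfolding I_def sum.cartesian_product' by (intro sum.cong refl) (simp add: cov a_def)
  also have "\<dots> = (\<Sum>s\<in>{1..T}. \<Sum>i\<in>UNIV. \<Sum>t\<in>{1..T}. c s $ i * c t $ i * Sig s t)"
    by (simp add: if_distrib cong: if_cong)
  also have "\<dots> = (\<Sum>s\<in>{1..T}. \<Sum>t\<in>{1..T}. \<Sum>i\<in>UNIV. c s $ i * c t $ i * Sig s t)"
    by (intro sum.cong refl sum.swap)
  also have "\<dots> = (\<Sum>s\<in>{1..T}. \<Sum>t\<in>{1..T}. Sig s t * (c s \<bullet> c t))"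
    by (simp add: inner_vec_def sum_distrib_left mult_ac)
  finally have V: "(\<integral>\<omega>. (\<Sum>k\<in>I. a k * X k \<omega>)\<^sup>2 \<partial>M) = (\<Sum>s\<in>{1..T}. \<Sum>t\<in>{1..T}. Sig s t * (c s \<bullet> c t))" .
  have L: "(\<Sum>k\<in>I. a k * X k \<omega>) = (\<Sum>t\<in>{1..T}. c t \<bullet> w t \<omega>)" for \<omega>
    unfolding I_def sum.cartesian_product' by (simp add: a_def X_def inner_vec_def)
  show ?thesis
    using dich[of a] unfolding V unfolding L by blast
qed

text \<open>Every combination of coordinates of \<open>w\<close> is a functional \<open>L d\<close>
  of the \<open>z t\<close>, with variance \<open>V d\<close>. It is normal unless
  \<open>V d = 0\<close>, which a singular \<open>Sig\<close> can cause and which is the degenerate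
  alternative.\<close>

lemma (in prob_space) gaussian_process_of_standard:
  fixes z :: "nat \<Rightarrow> 'a \<Rightarrow> real ^ 'n"
  assumes z: "\<And>t. t \<in> {1..T} \<Longrightarrow> z t \<in> borel_measurable M"
    and char: "\<And>d. (\<integral>\<omega>. cis (\<Sum>t\<in>{1..T}. d t \<bullet> z t \<omega>) \<partial>M) = of_real (exp (- ((\<Sum>t\<in>{1..T}. d t \<bullet> d t) / 2)))"
    and w: "\<And>t. t \<in> {1..T} \<Longrightarrow> w t \<in> borel_measurable M"
    and w_eq: "\<And>\<omega> t. \<omega> \<in> space M \<Longrightarrow> t \<in> {1..T} \<Longrightarrow> w t \<omega> = (\<Sum>s\<in>{1..T}. Om s t *\<^sub>R z s \<omega>)"
    and Sig: "\<And>s t. s \<in> {1..T} \<Longrightarrow> t \<in> {1..T} \<Longrightarrow> Sig s t = (\<Sum>k\<in>{1..T}. Om k s * Om k t)"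
  shows "gaussian_process_cov M T Sig w"
proof -
  note [measurable] = z w
  define L where "L d \<omega> = (\<Sum>t\<in>{1..T}. d t \<bullet> z t \<omega>)" for d and \<omega> :: 'a
  define V where "V d = (\<Sum>t\<in>{1..T}. d t \<bullet> d t)" for d :: "nat \<Rightarrow> real ^ 'n"
  have [measurable]: "L d \<in> borel_measurable M" for d
    unfolding L_def by measurable
  have V0: "V d \<ge> 0" for d by (simp add: V_def sum_nonneg)
  have L0: "L d \<omega> = 0" if "V d = 0" for d \<omega>
    using that by (auto simp: V_def L_def sum_nonneg_eq_0_iff intro!: sum.neutral)
  have Ln: "distributed M lborel (L d) (normal_density 0 (sqrt (V d)))" if "V d > 0" for d
  proof (rule distributed_normal_if_char)
    fix u
    have "(\<integral>\<omega>. cis (u * L d \<omega>) \<partial>M) = (\<integral>\<omega>. cis (\<Sum>t\<in>{1..T}. (u *\<^sub>R d t) \<bullet> z t \<omega>) \<partial>M)"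
      by (simp add: L_def sum_distrib_left)
    also have "\<dots> = of_real (exp (- ((sqrt (V d) * u)\<^sup>2) / 2))"
      unfolding char using that by (simp add: V_def power_mult_distrib sum_distrib_left sum_distrib_right power2_eq_square mult_ac)
    finally show "(\<integral>\<omega>. cis (u * L d \<omega>) \<partial>M) = of_real (exp (- ((sqrt (V d) * u)\<^sup>2) / 2))" .
  qed (use that in auto)
  have L2: "integrable M (\<lambda>\<omega>. (L d \<omega>)\<^sup>2)" "(\<integral>\<omega>. (L d \<omega>)\<^sup>2 \<partial>M) = V d" for d
  proof -
    have "integrable M (\<lambda>\<omega>. (L d \<omega>)\<^sup>2) \<and> (\<integral>\<omega>. (L d \<omega>)\<^sup>2 \<partial>M) = V d"
    proof (cases "V d = 0")
      case False
      then have "V d > 0" using V0[of d] by simp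
      then show ?thesis using normal_second_moment[OF Ln[of d]] by simp
    qed (simp add: L0)
    then show "integrable M (\<lambda>\<omega>. (L d \<omega>)\<^sup>2)" "(\<integral>\<omega>. (L d \<omega>)\<^sup>2 \<partial>M) = V d" by auto
  qed
  define D where "D t i = (\<lambda>s. Om s t *\<^sub>R (axis i 1 :: real ^ 'n))" for t i
  have wL: "w t \<omega> $ i = L (D t i) \<omega>" if "\<omega> \<in> space M" "t \<in> {1..T}" for t i \<omega>
    using that by (simp add: w_eq L_def D_def inner_axis')
  have cov: "(\<integral>\<omega>. w s \<omega> $ i * w t \<omega> $ j \<partial>M) = (if i = j then Sig s t else 0)"
    if st: "s \<in> {1..T}" "t \<in> {1..T}" for s t i j
  proof -
    let ?a = "D s i" and ?b = "D t j"
    have "(\<integral>\<omega>. w s \<omega> $ i * w t \<omega> $ j \<partial>M) = (\<integral>\<omega>. L ?a \<omega> * L ?b \<omega> \<partial>M)"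
      using st by (intro Bochner_Integration.integral_cong) (auto simp: wL)
    \<comment> \<open>Polarization reduces covariances to the variances known from
      \<open>L2\<close>.\<close>
    also have "\<dots> = (\<integral>\<omega>. ((L (\<lambda>k. ?a k + ?b k) \<omega>)\<^sup>2 - (L ?a \<omega>)\<^sup>2 - (L ?b \<omega>)\<^sup>2) / 2 \<partial>M)"
      by (intro Bochner_Integration.integral_cong refl)
        (simp add: L_def inner_add_left sum.distrib power2_eq_square algebra_simps)
    also have "\<dots> = (V (\<lambda>k. ?a k + ?b k) - V ?a - V ?b) / 2"
      using L2 by simp
    also have "\<dots> = (\<Sum>k\<in>{1..T}. ?a k \<bullet> ?b k)"
      by (simp add: V_def inner_add sum.distrib inner_commute sum_distrib_left mult.commute)
    also have "\<dots> = (if i = j then Sig s t else 0)"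
      using st by (auto simp: D_def inner_axis_axis Sig mult.commute)
    finally show ?thesis .
  qed
  have "centered_gaussian_family M (\<lambda>(t, i) \<omega>. w t \<omega> $ i) ({1..T} \<times> UNIV)"
    unfolding centered_gaussian_family_def
  proof (intro conjI allI ballI)
    fix k assume "k \<in> {1..T} \<times> (UNIV :: 'n set)"
    then show "(\<lambda>(t, i) \<omega>. w t \<omega> $ i) k \<in> borel_measurable M" by auto
  next
    fix c :: "nat \<times> 'n \<Rightarrow> real"
    let ?S = "\<lambda>\<omega>. \<Sum>k\<in>{1..T} \<times> UNIV. c k * (\<lambda>(t, i) \<omega>. w t \<omega> $ i) k \<omega>"
    define d where "d = (\<lambda>s. \<Sum>k\<in>{1..T} \<times> UNIV. c k *\<^sub>R D (fst k) (snd k) s)"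
    have S: "?S \<omega> = L d \<omega>" if "\<omega> \<in> space M" for \<omega>
    proof -
      have "?S \<omega> = (\<Sum>k\<in>{1..T} \<times> UNIV. c k * L (D (fst k) (snd k)) \<omega>)"
        using that by (intro sum.cong refl) (auto simp: wL)
      also have "\<dots> = (\<Sum>s\<in>{1..T}. \<Sum>k\<in>{1..T} \<times> UNIV. c k * (D (fst k) (snd k) s \<bullet> z s \<omega>))"
        unfolding L_def sum_distrib_left by (rule sum.swap)
      also have "\<dots> = L d \<omega>"
        by (simp add: L_def d_def inner_sum_left)
      finally show ?thesis .
    qed
    have [measurable]: "?S \<in> borel_measurable M"
      by (rule measurable_cong[THEN iffD2, of _ _ "L d"]) (auto simp only: S, simp)
    show "(AE \<omega> in M. ?S \<omega> = 0) \<or> (\<exists>\<sigma>>0. distributed M lborel ?S (normal_density 0 \<sigma>))"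
    proof (cases "V d = 0")
      case True
      then show ?thesis by (intro disjI1 AE_I2) (simp only: S L0)
    next
      case False
      then have "V d > 0" using V0[of d] by simp
      moreover have "distributed M lborel ?S (normal_density 0 (sqrt (V d)))"
      proof -
        have "distr M lborel ?S = distr M lborel (L d)"
          by (intro distr_cong refl S)
        then show ?thesis using Ln[OF \<open>V d > 0\<close>] \<open>?S \<in> borel_measurable M\<close> by (simp add: distributed_def)
      qed
      ultimately show ?thesis by (intro disjI2 exI[of _ "sqrt (V d)"]) auto
    qed
  qed
  then show ?thesis
    using cov by (auto simp: gaussian_process_cov_def)
qed

section \<open>The recursions defining the coupling\<close>

text \<open>\<open>drift_process m w\<close> solves \<open>y\<^sub>t = m\<^sub>t(y\<^sub>1, \<dots>, y\<^sub>t\<^sub>-\<^sub>1) + w\<^sub>t\<close>, and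
  \<open>gs_process v x\<close> is the sequence of the \<open>q\<^sub>t\<close> with \<open>x\<^sub>t\<close> in place of \<open>f\<^sub>t(y\<^sub>1, \<dots>, y\<^sub>t\<^sub>-\<^sub>1)\<close>.\<close>

function drift_process :: "(nat \<Rightarrow> (nat \<Rightarrow> 'b) \<Rightarrow> 'b :: plus) \<Rightarrow> (nat \<Rightarrow> 'b) \<Rightarrow> nat \<Rightarrow> 'b" where
  "drift_process m w t = m t (\<lambda>s. if s \<in> {1..<t} then drift_process m w s else undefined) + w t"
  by pat_completeness auto
termination by (relation "Wellfounded.measure (\<lambda>(m, w, t). t)") auto

declare drift_process.simps [simp del]

function gs_process :: "(nat \<Rightarrow> real ^ 'n) \<Rightarrow> (nat \<Rightarrow> real ^ 'n) \<Rightarrow> nat \<Rightarrow> real ^ 'n" where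
  "gs_process v x t = gs_next t v (\<lambda>s. if s \<in> {1..<t} then gs_process v x s else 0) (x t)"
  by pat_completeness auto
termination by (relation "Wellfounded.measure (\<lambda>(v, x, t). t)") auto

declare gs_process.simps [simp del]

text \<open>The default \<open>undefined\<close> in the recursion is the value that
  \<open>restrict\<close> takes outside its set, so the recursion has exactly the form in which
  \<open>y\<close> is specified.\<close>

lemma drift_process_eq:
  "drift_process m w t = m t (restrict (drift_process m w) {1..<t}) + w t"
  unfolding restrict_def by (rule drift_process.simps)

lemma drift_process_unique:
  assumes "\<And>t. t \<in> {1..T} \<Longrightarrow> y t = m t (restrict y {1..<t}) + w t" and "t \<in> {1..T}"
  shows "y t = drift_process m w t"
  using assms(2)
proof (induction t rule: less_induct)
  case (less t)
  have "restrict y {1..<t} = restrict (drift_process m w) {1..<t}"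
    using less by (intro restrict_ext) auto
  with assms(1)[OF less.prems] show ?case
    by (simp add: drift_process_eq[of m w t])
qed

lemma drift_process_cong:
  assumes "\<And>s. s \<in> {1..t} \<Longrightarrow> w s = w' s" "1 \<le> t"
  shows "drift_process m w t = drift_process m w' t"
proof (rule drift_process_unique[where T=t])
  fix s assume "s \<in> {1..t}"
  then show "drift_process m w s = m s (restrict (drift_process m w) {1..<s}) + w' s"
    using assms(1)[of s] drift_process_eq[of m w s] by simp
qed (use assms(2) in simp)

lemma borel_measurable_drift_process:
  fixes w :: "'a \<Rightarrow> nat \<Rightarrow> 'b :: {second_countable_topology, real_normed_vector}"
  assumes m: "\<And>t. t \<in> {1..T} \<Longrightarrow> m t \<in> measurable (PiM {1..<t} (\<lambda>_. borel)) borel"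
    and w: "\<And>t. t \<in> {1..T} \<Longrightarrow> (\<lambda>\<omega>. w \<omega> t) \<in> borel_measurable N" and t: "t \<in> {1..T}"
  shows "(\<lambda>\<omega>. drift_process m (w \<omega>) t) \<in> borel_measurable N"
  using t
proof (induction t rule: less_induct)
  case (less t)
  have "(\<lambda>\<omega>. restrict (drift_process m (w \<omega>)) {1..<t}) \<in> measurable N (PiM {1..<t} (\<lambda>_. borel))"
    using less by (intro measurable_restrict) auto
  from measurable_compose[OF this m[OF less.prems]] w[OF less.prems]
  have "(\<lambda>\<omega>. m t (restrict (drift_process m (w \<omega>)) {1..<t}) + w \<omega> t) \<in> borel_measurable N"
    by simp
  then show ?case by (simp add: drift_process_eq[of _ _ t])
qed

lemma gs_next_cong:
  assumes "\<And>s. s \<in> {1..<t} \<Longrightarrow> q s = q' s"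
  shows "gs_next t v q x = gs_next t v q' x"
proof -
  have i: "q ` {1..<t} = q' ` {1..<t}"
    using assms by (intro image_cong) auto
  have s: "(\<Sum>s\<in>{1..<t}. (c * (q s \<bullet> u)) *\<^sub>R q s) = (\<Sum>s\<in>{1..<t}. (c * (q' s \<bullet> u)) *\<^sub>R q' s)" for c u
    using assms by (intro sum.cong) auto
  show ?thesis unfolding gs_next_def i s ..
qed

lemma gs_process_eq: "gs_process v x t = gs_next t v (gs_process v x) (x t)"
  by (subst gs_process.simps) (auto intro: gs_next_cong)

lemma gs_process_unique:
  assumes "\<And>t. t \<in> {1..T} \<Longrightarrow> q t = gs_next t v q (x t)" and "t \<in> {1..T}"
  shows "q t = gs_process v x t"
  using assms(2)
proof (induction t rule: less_induct)
  case (less t)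
  have "q t = gs_next t v q (x t)" by (rule assms(1)[OF less.prems])
  also have "\<dots> = gs_next t v (gs_process v x) (x t)"
    using less by (intro gs_next_cong) auto
  finally show ?case by (simp only: gs_process_eq[of v x t])
qed

lemma gs_process_cong:
  assumes "\<And>s. s \<in> {1..t} \<Longrightarrow> x s = x' s" "1 \<le> t"
  shows "gs_process v x t = gs_process v x' t"
proof (rule gs_process_unique[where T=t])
  fix s assume "s \<in> {1..t}"
  then show "gs_process v x s = gs_next s v (gs_process v x) (x' s)"
    using assms(1)[of s] gs_process_eq[of v x s] by simp
qed (use assms(2) in simp)

lemma gs_process_orthogonal:
  fixes v :: "nat \<Rightarrow> real ^ 'n"
  assumes v: "span (v ` {1..CARD('n)}) = UNIV" and k: "k \<le> CARD('n)"
  shows "orthogonal_upto k (gs_process v x)"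
  using k
proof (induction k)
  case (Suc k)
  then show ?case
    by (intro gs_next_orthogonal[OF _ v _ gs_process_eq]) auto
qed (simp add: orthogonal_upto_def)

lemma borel_measurable_residual:
  fixes q :: "'a \<Rightarrow> nat \<Rightarrow> real ^ 'n"
  assumes "\<And>s. s \<in> {1..k} \<Longrightarrow> (\<lambda>\<omega>. q \<omega> s) \<in> borel_measurable N" and [measurable]: "u \<in> borel_measurable N"
  shows "(\<lambda>\<omega>. residual k (q \<omega>) (u \<omega>)) \<in> borel_measurable N"
proof -
  have [measurable]: "(\<lambda>\<omega>. q \<omega> s) \<in> borel_measurable N" if "s \<in> {1..k}" for s
    using assms(1) that .
  show ?thesis unfolding residual_def by measurable
qed

lemma borel_measurable_gs_process:
  fixes v :: "nat \<Rightarrow> real ^ 'n"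
  assumes v: "span (v ` {1..CARD('n)}) = UNIV"
    and x: "\<And>s. s \<in> {1..t} \<Longrightarrow> (\<lambda>\<omega>. x \<omega> s) \<in> borel_measurable N" and t: "1 \<le> t" "t \<le> CARD('n)"
  shows "(\<lambda>\<omega>. gs_process v (x \<omega>) t) \<in> borel_measurable N"
  using t x
proof (induction t rule: less_induct)
  case (less t)
  then obtain k where k: "t = Suc k" by (cases t) auto
  let ?q = "\<lambda>\<omega>. gs_process v (x \<omega>)"
  have q: "(\<lambda>\<omega>. ?q \<omega> s) \<in> borel_measurable N" if "s \<in> {1..k}" for s
    using that k less.prems by (intro less.IH) auto
  have [measurable]: "(\<lambda>\<omega>. x \<omega> t) \<in> borel_measurable N"
    using less.prems by auto
  have [measurable]: "(\<lambda>\<omega>. residual k (?q \<omega>) (x \<omega> t)) \<in> borel_measurable N"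
    by (rule borel_measurable_residual[OF q]) auto
  have [measurable]: "(\<lambda>\<omega>. residual k (?q \<omega>) (v j)) \<in> borel_measurable N" for j
    by (rule borel_measurable_residual[OF q]) auto
  let ?J = "\<lambda>\<omega>. LEAST j. j \<in> {1..CARD('n)} \<and> residual k (?q \<omega>) (v j) \<noteq> 0"
  \<comment> \<open>The selected index lives in a countable discrete space, so composing it with
    \<open>v\<close> is measurable.\<close>
  have "?J \<in> measurable N (count_space UNIV)"
    by measurable
  from measurable_compose[OF this, of v borel]
  have [measurable]: "(\<lambda>\<omega>. v (?J \<omega>)) \<in> borel_measurable N" by simp
  define u where "u = (\<lambda>\<omega>. if residual k (?q \<omega>) (x \<omega> t) \<noteq> 0 then x \<omega> t else v (?J \<omega>))"
  have u: "u \<in> borel_measurable N"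
    unfolding u_def by measurable
  have [measurable]: "(\<lambda>\<omega>. residual k (?q \<omega>) (u \<omega>)) \<in> borel_measurable N"
    by (rule borel_measurable_residual[OF q u])
  have eq: "gs_process v (x \<omega>) t = (sqrt (real CARD('n)) / norm (residual k (?q \<omega>) (u \<omega>))) *\<^sub>R residual k (?q \<omega>) (u \<omega>)" for \<omega>
  proof -
    have "orthogonal_upto k (?q \<omega>)"
      using v less.prems k by (intro gs_process_orthogonal) auto
    from trans[OF gs_process_eq gs_next_residual[OF this]] show ?thesis
      unfolding u_def k Let_def .
  qed
  show ?case unfolding eq by measurable
qed

section \<open>The closed formula for \<open>z t\<close>\<close>

lemma inner_z_next_old:
  fixes q :: "nat \<Rightarrow> real ^ 'n"
  assumes q: "orthogonal_upto t q" and st: "s \<in> {1..t}"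
  shows "z_next t e A A' q \<bullet> q s =
    (if s = t then (1/2) * (q t \<bullet> (A *v q t) + real CARD('n) * A' $ e t $ e t)
     else real CARD('n) * A' $ e s $ e t)"
proof -
  let ?n = "real CARD('n)"
  let ?b = "\<lambda>s. A' $ e s $ e t - (1 / ?n) * (q s \<bullet> (A *v q t))"
  have "z_next t e A A' q \<bullet> q s = (A *v q t) \<bullet> q s + ((1/2) * ?b t) * (q t \<bullet> q s) + (\<Sum>r\<in>{1..<t}. ?b r * (q r \<bullet> q s))"
    by (simp add: z_next_def inner_add_left inner_sum_left)
  also have "(\<Sum>r\<in>{1..<t}. ?b r * (q r \<bullet> q s)) = (\<Sum>r\<in>{1..<t}. if r = s then ?b s * ?n else 0)"
    using st by (intro sum.cong refl) (auto simp: orthogonal_uptoD[OF q])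
  also have "\<dots> = (if s < t then ?b s * ?n else 0)"
    using st by auto
  also have "q t \<bullet> q s = (if s = t then ?n else 0)"
    using st by (subst orthogonal_uptoD[OF q]) auto
  finally show ?thesis
    using st by (auto simp: inner_commute algebra_simps)
qed

text \<open>\<open>z_next s\<close> differs from \<open>A *v q s\<close> by a combination of
  \<open>q 1\<close>, ..., \<open>q s\<close>, all orthogonal to \<open>q t\<close>.\<close>

lemma inner_z_next_future:
  fixes q :: "nat \<Rightarrow> real ^ 'n"
  assumes q: "orthogonal_upto r q" and "s < t" "t \<le> r" "1 \<le> s"
  shows "z_next s e A A' q \<bullet> q t = (A *v q s) \<bullet> q t"
proof -
  have "q s \<bullet> q t = 0"
    using assms by (subst orthogonal_uptoD[OF q]) auto
  moreover have "(\<Sum>u\<in>{1..<s}. a u * (q u \<bullet> q t)) = 0" for a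
    using assms by (intro sum.neutral) (auto simp: orthogonal_uptoD[OF q])
  ultimately show ?thesis
    by (simp add: z_next_def inner_add_left inner_sum_left)
qed

text \<open>The coefficient of \<open>q s\<close> is compared in three ranges. For s < t symmetry of
  \<open>A\<close> turns <z_s, q_t> into <q_s, A q_t>; for s = t the averaging leaves one half; for
  s > t the term <z_s, q_t> / n equals A'_{ts} = A'_{st} and cancels, so extending the sums beyond t
  changes nothing.\<close>

lemma z_next_eq_full_sum:
  fixes q :: "nat \<Rightarrow> real ^ 'n"
  assumes q: "orthogonal_upto r q" and t: "1 \<le> t" "t \<le> r"
    and A: "transpose A = A" and A': "transpose A' = A'"
    and z: "\<And>s. s \<in> {1..r} \<Longrightarrow> z s = z_next s e A A' q"
  shows "z t = A *v q t - (\<Sum>s\<in>{1..r}. ((1 / real CARD('n)) * (z s \<bullet> q t)) *\<^sub>R q s)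
     + (\<Sum>s\<in>{1..r}. (A' $ e s $ e t) *\<^sub>R q s)"
proof -
  let ?n = "real CARD('n)"
  let ?b = "\<lambda>s. A' $ e s $ e t - (1 / ?n) * (q s \<bullet> (A *v q t))"
  have coef: "A' $ e s $ e t - (1 / ?n) * (z s \<bullet> q t) = (if s < t then ?b s else if s = t then (1/2) * ?b t else 0)"
    if s: "s \<in> {1..r}" for s
  proof -
    consider "s < t" | "s = t" | "t < s" by linarith
    then show ?thesis
    proof cases
      case 1
      have "q s \<bullet> (A *v q t) = (A *v q s) \<bullet> q t"
        by (simp add: dot_lmul_matrix[symmetric] transpose_matrix_vector[symmetric] A)
      then show ?thesis using 1 s t by (simp add: z inner_z_next_future[OF q])
    next
      case 2
      then show ?thesis
        using inner_z_next_old[OF orthogonal_upto_mono[OF q t(2)], of t e A A'] s t by (simp add: z field_simps)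
    next
      case 3
      have "A' $ e t $ e s = A' $ e s $ e t" by (rule symmetric_matrix_nth[OF A'])
      then show ?thesis
        using 3 s t inner_z_next_old[OF orthogonal_upto_mono[OF q, of s], of t e A A'] by (simp add: z)
    qed
  qed
  have "(\<Sum>s\<in>{1..r}. (A' $ e s $ e t) *\<^sub>R q s) - (\<Sum>s\<in>{1..r}. ((1 / ?n) * (z s \<bullet> q t)) *\<^sub>R q s)
     = (\<Sum>s\<in>{1..r}. (if s < t then ?b s else if s = t then (1/2) * ?b t else 0) *\<^sub>R q s)"
    unfolding sum_subtractf[symmetric] scaleR_left_diff_distrib[symmetric]
    by (intro sum.cong refl) (simp only: coef)
  also have "\<dots> = (\<Sum>s\<in>insert t {1..<t}. (if s < t then ?b s else (1/2) * ?b t) *\<^sub>R q s)"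
    using t by (intro sum.mono_neutral_cong_right) auto
  also have "\<dots> = ((1/2) * ?b t) *\<^sub>R q t + (\<Sum>s\<in>{1..<t}. ?b s *\<^sub>R q s)"
    by simp
  finally have "A *v q t - (\<Sum>s\<in>{1..r}. ((1 / ?n) * (z s \<bullet> q t)) *\<^sub>R q s) + (\<Sum>s\<in>{1..r}. (A' $ e s $ e t) *\<^sub>R q s)
     = A *v q t + ((1/2) * ?b t) *\<^sub>R q t + (\<Sum>s\<in>{1..<t}. ?b s *\<^sub>R q s)"
    by (simp add: algebra_simps)
  then show ?thesis
    using z[of t] t by (simp add: z_next_def)
qed

section \<open>The coupling as a strategy driven by its own outputs\<close>

theorem theorem3:
  fixes M :: "'a measure" and T :: nat
    and Sig Omega :: "nat \<Rightarrow> nat \<Rightarrow> real"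
    and f m :: "nat \<Rightarrow> (nat \<Rightarrow> real^'n) \<Rightarrow> real^'n"
    and e :: "nat \<Rightarrow> 'n" and v :: "nat \<Rightarrow> real^'n"
    and A A' :: "'a \<Rightarrow> real^'n^'n"
    and q z w y :: "nat \<Rightarrow> 'a \<Rightarrow> real^'n"
  assumes M: "prob_space M"
    and T: "1 \<le> T" "T \<le> CARD('n)"
    and Sigma_sym: "\<forall>s\<in>{1..T}. \<forall>t\<in>{1..T}. Sig s t = Sig t s"
    and Sigma_psd: "\<forall>x :: nat \<Rightarrow> real. 0 \<le> (\<Sum>s\<in>{1..T}. \<Sum>t\<in>{1..T}. x s * Sig s t * x t)"
    and Omega_upper: "\<forall>s\<in>{1..T}. \<forall>t\<in>{1..T}. t < s \<longrightarrow> Omega s t = 0"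
    and Omega_diag: "\<forall>t\<in>{1..T}. 0 \<le> Omega t t"
    and Sigma_Omega: "\<forall>s\<in>{1..T}. \<forall>t\<in>{1..T}. Sig s t = (\<Sum>k\<in>{1..T}. Omega k s * Omega k t)"
    and f_meas: "\<forall>t\<in>{1..T}. f t \<in> measurable (PiM {1..<t} (\<lambda>_. borel)) borel"
    and m_meas: "\<forall>t\<in>{1..T}. m t \<in> measurable (PiM {1..<t} (\<lambda>_. borel)) borel"
    and e_bij: "bij_betw e {1..CARD('n)} UNIV"
    and v_basis: "inj_on v {1..CARD('n)}" "independent (v ` {1..CARD('n)})"
                 "span (v ` {1..CARD('n)}) = UNIV"
    and GOE: "two_iid_GOE M e A A'"
    and q_def: "\<forall>\<omega>\<in>space M. \<forall>t\<in>{1..T}.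
                  q t \<omega> = gs_next t v (\<lambda>s. q s \<omega>) (f t (restrict (\<lambda>s. y s \<omega>) {1..<t}))"
    and z_def: "\<forall>\<omega>\<in>space M. \<forall>t\<in>{1..T}. z t \<omega> = z_next t e (A \<omega>) (A' \<omega>) (\<lambda>s. q s \<omega>)"
    and w_def: "\<forall>\<omega>\<in>space M. \<forall>t\<in>{1..T}. w t \<omega> = (\<Sum>s\<in>{1..t}. Omega s t *\<^sub>R z s \<omega>)"
    and y_def: "\<forall>\<omega>\<in>space M. \<forall>t\<in>{1..T}.
                  y t \<omega> = m t (restrict (\<lambda>s. y s \<omega>) {1..<t}) + w t \<omega>"
  shows
    "prob_space.indep_vars M (\<lambda>_. borel) z {1..T}
     \<and> (\<forall>t\<in>{1..T}. prob_space.indep_vars M (\<lambda>_. borel) (\<lambda>i \<omega>. z t \<omega> $ i) UNIV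
                    \<and> (\<forall>i. distributed M lborel (\<lambda>\<omega>. z t \<omega> $ i) std_normal_density))
     \<and> gaussian_process_cov M T Sig w
     \<and> (\<forall>(N :: 'b measure) (w' :: nat \<Rightarrow> 'b \<Rightarrow> real^'n) y'.
          prob_space N \<and> gaussian_process_cov N T Sig w'
          \<and> (\<forall>\<omega>\<in>space N. \<forall>t\<in>{1..T}. y' t \<omega> = m t (restrict (\<lambda>s. y' s \<omega>) {1..<t}) + w' t \<omega>)
          \<longrightarrow> distr N (PiM {1..T} (\<lambda>_. borel)) (\<lambda>\<omega>. restrict (\<lambda>t. y' t \<omega>) {1..T})
              = distr M (PiM {1..T} (\<lambda>_. borel)) (\<lambda>\<omega>. restrict (\<lambda>t. y t \<omega>) {1..T}))
     \<and> (\<forall>\<omega>\<in>space M. \<forall>t r. 1 \<le> t \<and> t \<le> r \<and> r \<le> T \<longrightarrow>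
          z t \<omega> = A \<omega> *v q t \<omega>
                  - (\<Sum>s\<in>{1..r}. ((1 / real CARD('n)) * (z s \<omega> \<bullet> q t \<omega>)) *\<^sub>R q s \<omega>)
                  + (\<Sum>s\<in>{1..r}. (A' \<omega> $ e s $ e t) *\<^sub>R q s \<omega>))"
proof -
  interpret prob_space M by (rule M)
  have v_span: "span (v ` {1..CARD('n)}) = UNIV" by (rule v_basis(3))
  \<comment> \<open>The coupling is read as a deterministic function of the \<open>z s\<close>:
    \<open>mix\<close> gives \<open>w\<close>, the drift recursion gives \<open>y\<close>, and
    \<open>X\<close> gives the inputs of Gram-Schmidt. Since \<open>X h t\<close> uses
    \<open>y\<close> only before \<open>t\<close>, \<open>Q h t\<close> depends on \<open>h\<close>
    strictly before \<open>t\<close>.\<close>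
  define mix where "mix h t = (\<Sum>s\<in>{1..t}. Omega s t *\<^sub>R h s)" for h :: "nat \<Rightarrow> real ^ 'n" and t
  define X where "X h t = f t (restrict (drift_process m (mix h)) {1..<t})" for h t
  define Q where "Q h = gs_process v (X h)" for h
  have X_causal: "X h t = X h' t" if "\<And>s. s \<in> {1..<t} \<Longrightarrow> h s = h' s" for h h' t
  proof -
    have "restrict (drift_process m (mix h)) {1..<t} = restrict (drift_process m (mix h')) {1..<t}"
      by (intro restrict_ext drift_process_cong) (auto simp: mix_def that intro!: sum.cong)
    then show ?thesis by (simp add: X_def)
  qed
  interpret S: strategy Q T e
  proof
    show "bij_betw e {1..CARD('n)} UNIV" "T \<le> CARD('n)" by (fact e_bij, fact T)
    show "orthogonal_upto T (Q h)" for h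
      unfolding Q_def by (rule gs_process_orthogonal[OF v_span T(2)])
    show "Q h t = Q h' t" if "t \<in> {1..T}" "\<And>s. s \<in> {1..<t} \<Longrightarrow> h s = h' s" for t h h'
      unfolding Q_def using that by (intro gs_process_cong X_causal) auto
    show "(\<lambda>h. Q h t) \<in> borel_measurable (PiM UNIV (\<lambda>_. borel))" if t: "t \<in> {1..T}" for t
      unfolding Q_def
    proof (rule borel_measurable_gs_process[OF v_span])
      fix s assume "s \<in> {1..t}"
      then have s: "s \<in> {1..T}" using t by auto
      have "(\<lambda>h. restrict (drift_process m (mix h)) {1..<s}) \<in> measurable (PiM UNIV (\<lambda>_. borel)) (PiM {1..<s} (\<lambda>_. borel))"
      proof (rule measurable_restrict)
        fix r assume "r \<in> {1..<s}"
        then have "r \<in> {1..T}" using s by auto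
        then show "(\<lambda>h. drift_process m (mix h) r) \<in> borel_measurable (PiM UNIV (\<lambda>_. borel))"
          using m_meas by (intro borel_measurable_drift_process[where T=T]) (auto simp: mix_def)
      qed
      from measurable_compose[OF this f_meas[rule_format, OF s]]
      show "(\<lambda>h. X h s) \<in> borel_measurable (PiM UNIV (\<lambda>_. borel))"
        by (simp add: X_def)
    qed (use t T in auto)
  qed
  have y_eq: "y t \<omega> = drift_process m (mix (\<lambda>s. z s \<omega>)) t" if \<omega>: "\<omega> \<in> space M" and t: "t \<in> {1..T}" for \<omega> t
  proof (rule drift_process_unique[of T "\<lambda>s. y s \<omega>", OF _ t])
    fix t assume "t \<in> {1..T}"
    then show "y t \<omega> = m t (restrict (\<lambda>s. y s \<omega>) {1..<t}) + mix (\<lambda>s. z s \<omega>) t"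
      using y_def w_def \<omega> unfolding mix_def by metis
  qed
  have q_eq: "q t \<omega> = Q (\<lambda>s. z s \<omega>) t" if \<omega>: "\<omega> \<in> space M" and t: "t \<in> {1..T}" for \<omega> t
    unfolding Q_def
  proof (rule gs_process_unique[of T "\<lambda>s. q s \<omega>", OF _ t])
    fix t assume t: "t \<in> {1..T}"
    have "restrict (\<lambda>s. y s \<omega>) {1..<t} = restrict (drift_process m (mix (\<lambda>s. z s \<omega>))) {1..<t}"
      using t \<omega> by (intro restrict_ext y_eq) auto
    then show "q t \<omega> = gs_next t v (\<lambda>s. q s \<omega>) (X (\<lambda>s. z s \<omega>) t)"
      using q_def[rule_format, OF \<omega> t] by (simp only: X_def)
  qed
  \<comment> \<open>With starting time 1 no value at a time in \<open>{1..T}\<close> is prescribed;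
    the zero history is a dummy.\<close>
  have z_eq: "z t \<omega> = S.run (\<lambda>_. 0) 1 (A \<omega>, A' \<omega>) t" if \<omega>: "\<omega> \<in> space M" and t: "t \<in> {1..T}" for \<omega> t
  proof (rule S.run_unique[of 1 "\<lambda>s. z s \<omega>", OF _ _ _ t])
    fix s assume s: "s \<in> {1..T}"
    have "z_next s e (A \<omega>) (A' \<omega>) (\<lambda>s. q s \<omega>) = z_next s e (A \<omega>) (A' \<omega>) (Q (\<lambda>s. z s \<omega>))"
      using s by (intro z_next_cong q_eq \<omega>) auto
    then show "z s \<omega> = z_next s e (fst (A \<omega>, A' \<omega>)) (snd (A \<omega>, A' \<omega>)) (Q (\<lambda>s. z s \<omega>))"
      using z_def[rule_format, OF \<omega> s] by simp
  qed auto
  note A_meas [measurable] = GOE_borel_measurable[OF GOE e_bij]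
  have z_meas [measurable]: "z t \<in> borel_measurable M" if t: "t \<in> {1..T}" for t
  proof (rule measurable_cong[THEN iffD2])
    show "z t \<omega> = S.run (\<lambda>_. 0) 1 (A \<omega>, A' \<omega>) t" if "\<omega> \<in> space M" for \<omega>
      using z_eq[OF that t] .
    show "(\<lambda>\<omega>. S.run (\<lambda>_. 0) 1 (A \<omega>, A' \<omega>) t) \<in> borel_measurable M"
      using t by (intro S.borel_measurable_run A_meas) auto
  qed
  \<comment> \<open>The standard Gaussian law is realized as the law of the first step, whose
    direction is deterministic; its characteristic function then follows from
    \<open>z_next_char'\<close>.\<close>
  define \<gamma> where "\<gamma> = distr M borel (\<lambda>\<omega>. z_next 1 e (A \<omega>) (A' \<omega>) (Q (\<lambda>_. 0)))"
  have z1_meas: "(\<lambda>\<omega>. z_next 1 e (A \<omega>) (A' \<omega>) (Q (\<lambda>_. 0))) \<in> borel_measurable M"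
    by (rule borel_measurable_z_next) auto
  have \<gamma>: "prob_space \<gamma>" "sets \<gamma> = sets borel"
    unfolding \<gamma>_def using z1_meas by (simp_all add: prob_space_distr)
  have \<gamma>_char: "(\<integral>x. cis (c \<bullet> x) \<partial>\<gamma>) = of_real (exp (- ((c \<bullet> c) / 2)))" for c
  proof -
    have "orthogonal_upto 1 (Q (\<lambda>_. 0))"
      using S.orthogonal T(1) by (rule orthogonal_upto_mono)
    then have "(\<integral>\<omega>. cis (c \<bullet> z_next 1 e (A \<omega>) (A' \<omega>) (Q (\<lambda>_. 0))) \<partial>M) = of_real (exp (- ((c \<bullet> c) / 2)))"
      using T by (intro z_next_char'[OF M GOE e_bij]) auto
    then show ?thesis
      unfolding \<gamma>_def using z1_meas by (subst integral_distr) auto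
  qed
  have T_ne: "{1..T} \<noteq> {}" using T by auto
  have z_prod: "emeasure M {\<omega> \<in> space M. \<forall>s\<in>{1..T}. z s \<omega> \<in> B s} = (\<Prod>s\<in>{1..T}. emeasure \<gamma> (B s))"
    if "\<And>s. s \<in> {1..T} \<Longrightarrow> B s \<in> sets borel" for B
  proof -
    have "{\<omega> \<in> space M. \<forall>s\<in>{1..T}. z s \<omega> \<in> B s} = {\<omega> \<in> space M. \<forall>s\<in>{1..T}. S.run (\<lambda>_. 0) 1 (A \<omega>, A' \<omega>) s \<in> B s}"
      using z_eq by auto
    then show ?thesis
      using T by (simp only:) (intro S.emeasure_run[OF M GOE \<gamma> \<gamma>_char that], auto)
  qed
  have z_indep: "indep_vars (\<lambda>_. borel) z {1..T}"
    and z_law: "\<And>t. t \<in> {1..T} \<Longrightarrow> distr M borel (z t) = \<gamma>"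
    using indep_vars_if_emeasure_prod[OF _ T_ne z_meas \<gamma> z_prod] by auto
  have z_char: "(\<integral>\<omega>. cis (c \<bullet> z t \<omega>) \<partial>M) = of_real (exp (- ((c \<bullet> c) / 2)))" if t: "t \<in> {1..T}" for c t
    unfolding \<gamma>_char[symmetric] z_law[OF t, symmetric] using z_meas[OF t] by (subst integral_distr) auto
  have z_joint: "(\<integral>\<omega>. cis (\<Sum>t\<in>{1..T}. d t \<bullet> z t \<omega>) \<partial>M) = of_real (exp (- ((\<Sum>t\<in>{1..T}. d t \<bullet> d t) / 2)))" for d
  proof -
    have "(\<integral>\<omega>. cis (\<Sum>t\<in>{1..T}. d t \<bullet> z t \<omega>) \<partial>M) = (\<Prod>t\<in>{1..T}. \<integral>\<omega>. cis (d t \<bullet> z t \<omega>) \<partial>M)"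
      unfolding cis_sum
    proof (rule indep_vars_lebesgue_integral)
      show "indep_vars (\<lambda>_. borel) (\<lambda>t \<omega>. cis (d t \<bullet> z t \<omega>)) {1..T}"
        by (rule indep_vars_compose2[OF z_indep, where Y="\<lambda>t x. cis (d t \<bullet> x)"]) simp
    qed (auto intro!: integrable_cis)
    also have "\<dots> = (\<Prod>t\<in>{1..T}. of_real (exp (- ((d t \<bullet> d t) / 2))))"
      by (intro prod.cong refl z_char)
    also have "\<dots> = of_real (exp (\<Sum>t\<in>{1..T}. - ((d t \<bullet> d t) / 2)))"
      by (simp add: exp_sum)
    finally show ?thesis
      by (simp add: sum_negf sum_divide_distrib)
  qed
  have coord_char: "(\<integral>\<omega>. cis (u * z t \<omega> $ i) \<partial>M) = of_real (exp (- (u\<^sup>2) / 2))" if t: "t \<in> {1..T}" for u t i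
    using z_char[OF t, of "axis i u"] by (simp add: inner_axis' inner_axis_axis power2_eq_square)
  have coord_law: "distributed M lborel (\<lambda>\<omega>. z t \<omega> $ i) std_normal_density" if t: "t \<in> {1..T}" for t i
    using z_meas[OF t] coord_char[OF t] by (intro distributed_normal_if_char) auto
  have coord_indep: "indep_vars (\<lambda>_. borel) (\<lambda>i \<omega>. z t \<omega> $ i) UNIV" if t: "t \<in> {1..T}" for t
  proof (rule indep_vars_if_char_factor)
    fix c :: "'n \<Rightarrow> real"
    have "(\<integral>\<omega>. cis (\<Sum>i\<in>UNIV. c i \<bullet> z t \<omega> $ i) \<partial>M) = (\<integral>\<omega>. cis ((\<chi> i. c i) \<bullet> z t \<omega>) \<partial>M)"
      by (simp add: inner_vec_def)
    also have "\<dots> = of_real (exp (- ((\<Sum>i\<in>UNIV. (c i)\<^sup>2) / 2)))"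
      unfolding z_char[OF t] by (simp add: inner_vec_def power2_eq_square)
    also have "\<dots> = (\<Prod>i\<in>UNIV. of_real (exp (- ((c i)\<^sup>2) / 2)))"
      by (simp add: exp_sum sum_negf[symmetric] sum_divide_distrib flip: of_real_prod)
    also have "\<dots> = (\<Prod>i\<in>UNIV. \<integral>\<omega>. cis (c i \<bullet> z t \<omega> $ i) \<partial>M)"
      by (simp add: coord_char[OF t])
    finally show "(\<integral>\<omega>. cis (\<Sum>i\<in>UNIV. c i \<bullet> z t \<omega> $ i) \<partial>M) = (\<Prod>i\<in>UNIV. \<integral>\<omega>. cis (c i \<bullet> z t \<omega> $ i) \<partial>M)" .
  qed (use z_meas[OF t] in auto)
  have w_eq: "w t \<omega> = (\<Sum>s\<in>{1..T}. Omega s t *\<^sub>R z s \<omega>)" if "\<omega> \<in> space M" "t \<in> {1..T}" for \<omega> t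
  proof -
    have "w t \<omega> = (\<Sum>s\<in>{1..t}. Omega s t *\<^sub>R z s \<omega>)" using w_def that by blast
    \<comment> \<open>Upper triangularity lets the sum run over all of \<open>{1..T}\<close>,
      matching the index range in \<open>Sigma_Omega\<close>.\<close>
    also have "\<dots> = (\<Sum>s\<in>{1..T}. Omega s t *\<^sub>R z s \<omega>)"
      using that Omega_upper by (intro sum.mono_neutral_left) auto
    finally show ?thesis .
  qed
  have w_meas [measurable]: "w t \<in> borel_measurable M" if t: "t \<in> {1..T}" for t
  proof (rule measurable_cong[THEN iffD2])
    show "w t \<omega> = (\<Sum>s\<in>{1..T}. Omega s t *\<^sub>R z s \<omega>)" if "\<omega> \<in> space M" for \<omega>
      using w_eq[OF that t] .
  qed measurable
  have w_gauss: "gaussian_process_cov M T Sig w"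
    by (rule gaussian_process_of_standard[OF z_meas z_joint w_meas w_eq Sigma_Omega[rule_format]])
  \<comment> \<open>\<open>F\<close> maps a path of \<open>w\<close> to the path of
    \<open>y\<close>. The same \<open>F\<close> serves on both probability spaces, so equality of
    the laws of the driving processes suffices.\<close>
  define F where "F g = (\<lambda>t\<in>{1..T}. drift_process m g t)" for g :: "nat \<Rightarrow> real ^ 'n"
  have F_meas: "F \<in> measurable (PiM {1..T} (\<lambda>_. borel)) (PiM {1..T} (\<lambda>_. borel))"
    unfolding F_def using m_meas
    by (intro measurable_restrict borel_measurable_drift_process[where T=T]) auto
  have F_law: "distr L (PiM {1..T} (\<lambda>_. borel)) (\<lambda>\<omega>. restrict (\<lambda>t. Y t \<omega>) {1..T})
     = distr (distr L (PiM {1..T} (\<lambda>_. borel)) (\<lambda>\<omega>. \<lambda>t\<in>{1..T}. W t \<omega>)) (PiM {1..T} (\<lambda>_. borel)) F"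
    if W: "\<And>t. t \<in> {1..T} \<Longrightarrow> W t \<in> borel_measurable L"
      and Y: "\<And>\<omega> t. \<omega> \<in> space L \<Longrightarrow> t \<in> {1..T} \<Longrightarrow> Y t \<omega> = m t (restrict (\<lambda>s. Y s \<omega>) {1..<t}) + W t \<omega>"
    for L :: "'c measure" and W Y
  proof -
    have "restrict (\<lambda>t. Y t \<omega>) {1..T} = F (\<lambda>t\<in>{1..T}. W t \<omega>)" if \<omega>: "\<omega> \<in> space L" for \<omega>
      unfolding F_def
    proof (rule restrict_ext)
      fix t assume t: "t \<in> {1..T}"
      show "Y t \<omega> = drift_process m (\<lambda>t\<in>{1..T}. W t \<omega>) t"
        by (rule drift_process_unique[of T "\<lambda>s. Y s \<omega>", OF _ t]) (simp add: Y[OF \<omega>])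
    qed
    then show ?thesis
      using F_meas W by (subst distr_distr) (auto intro!: distr_cong measurable_restrict)
  qed
  have law: "distr N (PiM {1..T} (\<lambda>_. borel)) (\<lambda>\<omega>. restrict (\<lambda>t. y' t \<omega>) {1..T})
              = distr M (PiM {1..T} (\<lambda>_. borel)) (\<lambda>\<omega>. restrict (\<lambda>t. y t \<omega>) {1..T})"
    if N: "prob_space N" and w': "gaussian_process_cov N T Sig w'"
      and y': "\<forall>\<omega>\<in>space N. \<forall>t\<in>{1..T}. y' t \<omega> = m t (restrict (\<lambda>s. y' s \<omega>) {1..<t}) + w' t \<omega>"
    for N :: "'b measure" and w' :: "nat \<Rightarrow> 'b \<Rightarrow> real ^ 'n" and y'
  proof -
    have w'_meas: "w' t \<in> borel_measurable N" if t: "t \<in> {1..T}" for t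
    proof (rule borel_measurable_vecI)
      fix i
      have "\<forall>k\<in>{1..T} \<times> UNIV. (\<lambda>(t, i) \<omega>. w' t \<omega> $ i) k \<in> borel_measurable N"
        using w' by (simp add: gaussian_process_cov_def centered_gaussian_family_def)
      from bspec[OF this, of "(t, i)"] t show "(\<lambda>\<omega>. w' t \<omega> $ i) \<in> borel_measurable N"
        by simp
    qed
    have "distr N (PiM {1..T} (\<lambda>_. borel)) (\<lambda>\<omega>. \<lambda>t\<in>{1..T}. w' t \<omega>)
        = distr M (PiM {1..T} (\<lambda>_. borel)) (\<lambda>\<omega>. \<lambda>t\<in>{1..T}. w t \<omega>)"
      using prob_space.gaussian_process_cov_char[OF N w'] gaussian_process_cov_char[OF w_gauss] N w'_meas w_meas
      by (intro distr_PiM_eq_if_char_eq) (auto intro: prob_space.finite_measure finite_measure_axioms)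
    moreover note F_law[OF w'_meas y'[rule_format]] F_law[OF w_meas y_def[rule_format]]
    ultimately show ?thesis by simp
  qed
  have id: "z t \<omega> = A \<omega> *v q t \<omega> - (\<Sum>s\<in>{1..r}. ((1 / real CARD('n)) * (z s \<omega> \<bullet> q t \<omega>)) *\<^sub>R q s \<omega>)
      + (\<Sum>s\<in>{1..r}. (A' \<omega> $ e s $ e t) *\<^sub>R q s \<omega>)"
    if \<omega>: "\<omega> \<in> space M" and t: "1 \<le> t" "t \<le> r" "r \<le> T" for \<omega> t r
  proof (rule z_next_eq_full_sum[of r "\<lambda>s. q s \<omega>" t "A \<omega>" "A' \<omega>" "\<lambda>s. z s \<omega>" e])
    show "orthogonal_upto r (\<lambda>s. q s \<omega>)"
      using orthogonal_upto_mono[OF S.orthogonal t(3), of "\<lambda>s. z s \<omega>"] q_eq[OF \<omega>] t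
      by (simp add: orthogonal_upto_def)
    show "transpose (A \<omega>) = A \<omega>" "transpose (A' \<omega>) = A' \<omega>"
      using GOE \<omega> by (auto simp: two_iid_GOE_def)
    show "z s \<omega> = z_next s e (A \<omega>) (A' \<omega>) (\<lambda>s. q s \<omega>)" if "s \<in> {1..r}" for s
      using z_def \<omega> that t by auto
  qed (use t in auto)
  show ?thesis
    using z_indep coord_indep coord_law w_gauss law id by blast
qed

end
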